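(* Let $X$ be an indecomposable continuum in a closed surface $S$. Then there exists a sequence $(U_n)_{n=1}^\infty$ of (not necessarily distinct) complementary domains of $X$ such that $\lim_{n\to\infty}\partial U_n=X$ in the Hausdorff metric.
   Context: A continuum is a compact connected metric space; it is indecomposable if it is not the union of two proper subcontinua. A closed surface is a compact connected 2-manifold without boundary, not necessarily orientable. A complementary domain of $X\subset S$ is a component of $S\setminus X$. Limits are in the Hausdorff metric on nonempty compact subsets of $S$ (for any metric compatible with the topology of $S$). *)

theory Defs
  imports "HOL-Analysis.Analysis"
begin

text \<open>A closed surface, presented as a subset S of a metric space (with the induced,
  compatible, metric): compact, connected, and locally homeomorphic to the plane
  (Hausdorff and second countable are automatic for compact metric spaces).\<close>
definition closed_surface :: "'a::metric_space set \<Rightarrow> bool" where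
  "closed_surface S \<longleftrightarrow> compact S \<and> connected S \<and> S \<noteq> {} \<and>
     (\<forall>x\<in>S. \<exists>U. openin (top_of_set S) U \<and> x \<in> U \<and>
                U homeomorphic (UNIV :: (real^2) set))"

definition continuum :: "'a::metric_space set \<Rightarrow> bool" where
  "continuum X \<longleftrightarrow> compact X \<and> connected X \<and> X \<noteq> {}"

definition indecomposable :: "'a::metric_space set \<Rightarrow> bool" where
  "indecomposable X \<longleftrightarrow> continuum X \<and>
     \<not> (\<exists>A B. continuum A \<and> continuum B \<and> A \<subset> X \<and> B \<subset> X \<and> A \<union> B = X)"

definition complementary_domain :: "'a::metric_space set \<Rightarrow> 'a set \<Rightarrow> 'a set \<Rightarrow> bool" where
  "complementary_domain S X U \<longleftrightarrow> U \<in> components (S - X)"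

definition hausdorff_dist :: "'a::metric_space set \<Rightarrow> 'a set \<Rightarrow> real" where
  "hausdorff_dist A B = max (SUP a\<in>A. infdist a B) (SUP b\<in>B. infdist b A)"

end

theory Submission
  imports Defs
begin

text \<open>Choose connected open sets \<open>B\<^sub>i\<close> around the points of a finite \<open>\<epsilon>\<close>-net of \<open>X\<close>; it suffices to find a
  domain meeting all of them, since its boundary then meets all of them too. Suppose that there is
  none, and let \<open>D\<^sub>i\<close> be the union of domains missing \<open>B\<^sub>i\<close>, so that the \<open>D\<^sub>i\<close> partition \<open>S - X\<close>.
  As \<open>X\<close> has many composants and each is dense, there are many continua \<open>L\<^sub>q \<subset> X\<close> that meet every
  \<open>B\<^sub>i\<close>, avoid a point \<open>p\<close> of \<open>X\<close>, and lie in different components of \<open>X\<close> minus a small disc at \<open>p\<close>.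
  Off that disc there are functions \<open>h\<^sub>q\<close> with values 0 and 1 on \<open>X\<close> that single out \<open>L\<^sub>q\<close>. The function
  \<open>\<theta>\<^sub>i\<^sub>q\<close> that equals \<open>exp (2\<pi>i h\<^sub>q)\<close> on \<open>D\<^sub>i\<close> and 1 elsewhere is continuous, and \<open>\<Prod>\<^sub>i \<theta>\<^sub>i\<^sub>q = exp (2\<pi>i h\<^sub>q)\<close>.
  The first cohomology of the punctured surface has finite rank, so there are integers \<open>\<alpha>\<^sub>q\<close>, not all
  zero, such that for each \<open>i\<close> the product of the \<open>\<theta>\<^sub>i\<^sub>q\<close> to the powers \<open>\<alpha>\<^sub>q\<close> has a continuous logarithm \<open>G\<^sub>i\<close>.
  Since \<open>\<theta>\<^sub>i\<^sub>q = 1\<close> on \<open>X \<union> B\<^sub>i\<close>, each \<open>G\<^sub>i\<close> takes the same value on all \<open>L\<^sub>q\<close>; the same holds for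
  \<open>\<Sum>\<^sub>i G\<^sub>i - 2\<pi>i \<Sum>\<^sub>q \<alpha>\<^sub>q h\<^sub>q\<close>, which forces all \<open>\<alpha>\<^sub>q\<close> to vanish.\<close>

section \<open>Composants of indecomposable continua\<close>

lemma continuum_Un:
  "continuum A \<Longrightarrow> continuum B \<Longrightarrow> A \<inter> B \<noteq> {} \<Longrightarrow> continuum (A \<union> B)"
  unfolding continuum_def by (auto simp: compact_Un intro: connected_Un)

lemma component_continuum:
  assumes "compact S" "C \<in> components S"
  shows "continuum C"
  using assms closedin_compact[OF assms(1) closedin_component[OF assms(2)]]
  by (simp add: continuum_def in_components_connected in_components_nonempty)

lemma proper_subcontinua_Un:
  assumes "indecomposable X" "continuum A" "continuum B" "A \<subset> X" "B \<subset> X"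
  shows "A \<union> B \<subset> X"
  using assms unfolding indecomposable_def by blast

text \<open>Interior points would make \<open>X\<close> decomposable. If \<open>X - C\<close> is
  connected, its closure misses an interior point of \<open>C\<close> and is a second proper
  subcontinuum; otherwise \<open>X - C\<close> splits into two relatively clopen pieces, and
  \<open>C\<close> with either piece is a proper subcontinuum.\<close>

lemma proper_subcontinuum_interior:
  assumes X: "indecomposable X" and C: "continuum C" "C \<subset> X"
  shows "top_of_set X interior_of C = {}"
proof (rule ccontr)
  assume "top_of_set X interior_of C \<noteq> {}"
  then obtain z V where V: "openin (top_of_set X) V" "z \<in> V" "V \<subseteq> C"
    by (auto simp: interior_of_def)
  have cX: "compact X" "connected X" and cC: "compact C" "connected C" "C \<noteq> {}"
    using X C by (auto simp: indecomposable_def continuum_def)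
  obtain O' where O': "open O'" "V = X \<inter> O'"
    using V(1) by (meson openin_open)
  show False
  proof (cases "connected (X - C)")
    case True
    let ?A = "closure (X - C)"
    have sub: "?A \<subseteq> X"
      using cX by (simp add: closure_minimal compact_imp_closed)
    then have "compact ?A"
      using cX by (metis closed_closure compact_Int_closed inf.absorb_iff2)
    then have "continuum ?A"
      unfolding continuum_def using True C by (auto intro: connected_imp_connected_closure)
    moreover have "O' \<inter> (X - C) = {}" "z \<in> O'"
      using O' V by auto
    then have "z \<notin> ?A"
      using open_Int_closure_eq_empty[OF O'(1)] by blast
    then have "?A \<subset> X"
      using V sub C by blast
    moreover have "?A \<union> C = X"
      using sub C(2) closure_subset by blast
    ultimately show False
      using proper_subcontinua_Un[OF X _ C(1) _ C(2)] by (metis psubset_eq)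
  next
    case False
    then obtain T where T: "openin (top_of_set (X - C)) T" "closedin (top_of_set (X - C)) T"
      "T \<noteq> {}" "T \<noteq> X - C"
      by (auto simp: connected_clopen)
    define T' where "T' = X - C - T"
    have T': "openin (top_of_set (X - C)) T'" "closedin (top_of_set (X - C)) T'"
      using T by (auto simp: T'_def openin_diff closedin_diff)
    have *: "continuum (C \<union> R)"
      if R: "openin (top_of_set (X - C)) R" "closedin (top_of_set (X - C)) R" for R
    proof -
      have "connected (C \<union> R)"
        using connected_Un_clopen_in_complement[OF cC(2) cX(2) _ R] C by auto
      moreover obtain F where F: "closed F" "R = (X - C) \<inter> F"
        using R(2) by (meson closedin_closed)
      \<comment> \<open>\<open>R\<close> need not be closed in \<open>X\<close>, but its limit
        points outside \<open>R\<close> lie in \<open>C\<close>.\<close>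
      have "C \<union> R = C \<union> (X \<inter> F)"
        using F C by blast
      then have "compact (C \<union> R)"
        using cC cX F by (simp add: compact_Un compact_Int_closed)
      ultimately show ?thesis
        using cC by (auto simp: continuum_def)
    qed
    have TX: "T \<subseteq> X - C"
      using T(1) openin_imp_subset by blast
    have "C \<union> T \<subset> X" "C \<union> T' \<subset> X" "(C \<union> T) \<union> (C \<union> T') = X"
      unfolding T'_def using TX T(3,4) C(2) by blast+
    then show False
      using proper_subcontinua_Un[OF X *[OF T(1,2)] *[OF T']] by (metis psubset_eq)
  qed
qed

text \<open>In the usual terminology, every composant is dense.\<close>

lemma composant_dense:
  assumes X: "indecomposable X" "X \<noteq> {q}" and q: "q \<in> X" and W: "open W" "W \<inter> X \<noteq> {}"
  shows "\<exists>C. continuum C \<and> C \<subset> X \<and> q \<in> C \<and> C \<inter> W \<noteq> {}"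
proof (cases "q \<in> W")
  case True
  then show ?thesis
    using X q by (intro exI[of _ "{q}"]) (auto simp: continuum_def)
next
  case False
  obtain w where w: "w \<in> W" "w \<in> X" using W by blast
  obtain e where e: "e > 0" "cball w e \<subseteq> W"
    using W w by (meson open_contains_cball)
  \<comment> \<open>Removing a ball about \<open>w\<close> keeps the component \<open>C\<close> of
    \<open>q\<close> proper. By boundary bumping \<open>C\<close> still reaches the frontier of what
    is left, which lies in \<open>cball w e\<close> and hence in \<open>W\<close>.\<close>
  define S where "S = X - ball w e"
  have cX: "compact X" "connected X"
    using X by (auto simp: indecomposable_def continuum_def)
  have cS: "closedin (top_of_set X) S"
    by (auto simp: S_def closedin_closed_eq Diff_eq intro: closedin_closed_Int)
  have compS: "compact S"
    using cX by (simp add: S_def compact_diff)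
  have qS: "q \<in> S"
    using False e(2) q by (auto simp: S_def subset_eq)
  have wS: "w \<notin> S" using e by (simp add: S_def)
  define C where "C = connected_component_set S q"
  have Ccomp: "C \<in> components S"
    using qS by (auto simp: C_def components_def)
  have "C \<inter> (top_of_set X) frontier_of S \<noteq> {}"
  proof (rule boundary_bumping_theorem_closed)
    show "C \<in> connected_components_of (subtopology (top_of_set X) S)"
    proof -
      have "subtopology (top_of_set X) S = top_of_set S"
        by (simp add: S_def subtopology_subtopology Int_absorb1)
      moreover have "connected_component_of (top_of_set S) = connected_component S"
        by (auto simp: fun_eq_iff connected_component_of_def connected_component_def connectedin_subtopology)
      ultimately show ?thesis
        using qS Ccomp by (simp add: connected_components_of_def components_def)
    qed
  qed (use cX cS w wS in \<open>auto simp: connectedin_def[symmetric] connected_space_subtopology compact_space_subtopology Hausdorff_space_subtopology\<close>)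
  moreover have "(top_of_set X) frontier_of S \<subseteq> cball w e"
  proof -
    have "(top_of_set X) frontier_of S \<subseteq> (top_of_set X) closure_of (X - S)"
      by (simp add: frontier_of_closures)
    also have "\<dots> \<subseteq> closure (X - S)"
      by (auto simp: closure_of_subtopology intro: subsetD[OF closure_mono, rotated])
    also have "\<dots> \<subseteq> cball w e"
      by (rule closure_minimal) (auto simp: S_def)
    finally show ?thesis .
  qed
  ultimately have "C \<inter> W \<noteq> {}"
    using e by blast
  moreover have "continuum C"
    using component_continuum[OF compS Ccomp] .
  moreover have "C \<subseteq> S" by (simp add: C_def connected_component_subset)
  moreover have "q \<in> C" using qS by (simp add: C_def)
  moreover have "S \<subseteq> X" by (auto simp: S_def)
  ultimately show ?thesis
    using wS w by (intro exI[of _ C] conjI) blast+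
qed

section \<open>Baire category and points in different composants\<close>

lemma compact_countable_dense:
  fixes X :: "'a::metric_space set"
  assumes "compact X"
  obtains D where "countable D" "D \<subseteq> X" "\<And>V. open V \<Longrightarrow> V \<inter> X \<noteq> {} \<Longrightarrow> V \<inter> D \<noteq> {}"
proof -
  have "\<exists>k. finite k \<and> k \<subseteq> X \<and> X \<subseteq> (\<Union>x\<in>k. ball x (1 / Suc n))" for n
    using compactE_image[OF assms, of X "\<lambda>x. ball x (1 / Suc n)"]
    by (metis UN_I centre_in_ball of_nat_0_less_iff open_ball subsetI zero_less_Suc zero_less_divide_1_iff)
  then obtain k where k: "\<And>n. finite (k n)" "\<And>n. k n \<subseteq> X" "\<And>n. X \<subseteq> (\<Union>x\<in>k n. ball x (1 / Suc n))"
    by metis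
  show thesis
  proof
    show "countable (\<Union>n. k n)" using k(1) by (simp add: countable_finite)
    show "(\<Union>n. k n) \<subseteq> X" using k(2) by blast
    fix V :: "'a set" assume V: "open V" "V \<inter> X \<noteq> {}"
    then obtain x e where x: "x \<in> V" "x \<in> X" "e > 0" "ball x e \<subseteq> V"
      by (meson disjoint_iff open_contains_ball)
    obtain n where n: "1 / Suc n < e" using x(3) nat_approx_posE by blast
    obtain y where y: "y \<in> k n" "x \<in> ball y (1 / Suc n)" using k(3) x(2) by blast
    then have "y \<in> ball x e" using n by (simp add: dist_commute)
    then show "V \<inter> (\<Union>n. k n) \<noteq> {}" using x(4) y(1) by blast
  qed
qed

text \<open>A Baire category argument: each composant is a countable union of nowhere dense sets.\<close>

lemma composants_not_cover:
  assumes X: "indecomposable X" and Q: "finite Q" "Q \<subseteq> X"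
  obtains y where "y \<in> X" "\<not> (\<exists>q\<in>Q. \<exists>C. continuum C \<and> C \<subset> X \<and> q \<in> C \<and> y \<in> C)"
proof -
  have cX: "compact X" "connected X" "X \<noteq> {}"
    using X by (auto simp: indecomposable_def continuum_def)
  obtain D where D: "countable D" "D \<subseteq> X" "\<And>V. open V \<Longrightarrow> V \<inter> X \<noteq> {} \<Longrightarrow> V \<inter> D \<noteq> {}"
    using compact_countable_dense[OF cX(1)] by blast
  \<comment> \<open>Every proper subcontinuum misses some ball of this countable family. If it
    contains a point of \<open>Q\<close>, it therefore lies in a member of \<open>G\<close>, so the
    countable family \<open>G\<close> covers the composants of all points of
    \<open>Q\<close>.\<close>
  define S where "S = (\<lambda>(d, n::nat). X - ball d (1 / Suc n))"
  define G where "G = (\<lambda>(q, z). connected_component_set (S z) q) ` {(q,z). (q,z) \<in> Q \<times> (D \<times> UNIV) \<and> q \<in> S z}"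
  have compS: "compact (S z)" for z
    using cX by (cases z) (simp add: S_def compact_diff)
  have cont: "continuum C \<and> C \<subset> X" if CG: "C \<in> G" for C
  proof -
    obtain q z where z: "C = connected_component_set (S z) q" "z \<in> D \<times> UNIV" "q \<in> S z"
      using CG unfolding G_def by (auto simp del: connected_component_eq_empty)
    then have "C \<in> components (S z)"
      by (auto simp: components_def)
    then have "continuum C"
      by (rule component_continuum[OF compS])
    moreover have "C \<subseteq> S z" using z by (simp add: connected_component_subset)
    moreover have "S z \<subset> X"
    proof -
      have "fst z \<in> X" "fst z \<notin> S z" "S z \<subseteq> X"
        using z(2) D(2) by (auto simp: S_def split: prod.splits)
      then show ?thesis by blast
    qed
    ultimately show ?thesis by blast
  qed
  have "top_of_set X interior_of (\<Union>G) = {}"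
  proof (rule Baire_category_alt)
    show "completely_metrizable_space (top_of_set X) \<or>
      locally_compact_space (top_of_set X) \<and> regular_space (top_of_set X)"
      using cX by (simp add: compact_imp_locally_compact_space compact_space_subtopology
          metrizable_imp_regular_space metrizable_space_euclidean metrizable_space_subtopology)
    have "countable (Q \<times> (D \<times> (UNIV::nat set)))"
      using D(1) Q(1) by (simp add: countable_finite)
    then have "countable {(q,z). (q,z) \<in> Q \<times> (D \<times> (UNIV::nat set)) \<and> q \<in> S z}"
      by (rule countable_subset[rotated]) auto
    then show "countable G"
      unfolding G_def by (rule countable_image)
    show "closedin (top_of_set X) T \<and> top_of_set X interior_of T = {}" if "T \<in> G" for T
      using cont[OF that] proper_subcontinuum_interior[OF X] cX
      by (auto simp: continuum_def closed_subset compact_imp_closed)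
  qed
  then have "X \<noteq> \<Union>G"
    using cX by (metis interior_of_topspace topspace_euclidean_subtopology)
  then obtain y where y: "y \<in> X" "y \<notin> \<Union>G"
    using cont by blast
  have False if "q \<in> Q" "continuum C" "C \<subset> X" "q \<in> C" "y \<in> C" for q C
  proof -
    have "open (- C)" "- C \<inter> X \<noteq> {}"
      using that by (auto simp: continuum_def compact_imp_closed)
    then obtain d where d: "d \<in> - C" "d \<in> D" using D(3) by blast
    then obtain e where e: "e > 0" "ball d e \<subseteq> - C"
      using \<open>open (- C)\<close> by (meson open_contains_ball)
    obtain n where n: "1 / Suc n < e" using e(1) nat_approx_posE by blast
    have CS: "C \<subseteq> S (d,n)"
      using e n that(3) by (force simp: S_def)
    then have "C \<subseteq> connected_component_set (S (d,n)) q"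
      using that by (simp add: connected_component_maximal continuum_def)
    moreover have "connected_component_set (S (d,n)) q \<in> G"
      using that d CS unfolding G_def by blast
    ultimately show False using y that by blast
  qed
  then show thesis using y(1) that by blast
qed

text \<open>Finitely many composants do not cover \<open>X\<close>, so points in new composants can
  be added one at a time. Having \<open>p\<close> in the separated set ensures that proper
  subcontinua through the chosen points avoid \<open>p\<close>.\<close>

lemma many_composants:
  assumes X: "indecomposable X" "X \<noteq> {p}" and p: "p \<in> X"
  obtains Q where "finite Q" "card Q = n" "Q \<subseteq> X" "p \<notin> Q"
     "pairwise (\<lambda>x y. \<not> (\<exists>C. continuum C \<and> C \<subset> X \<and> x \<in> C \<and> y \<in> C)) (insert p Q)"
proof -
  define R where "R = (\<lambda>x y. \<not> (\<exists>C. continuum C \<and> C \<subset> X \<and> x \<in> C \<and> y \<in> C))"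
  have "\<exists>Q. finite Q \<and> card Q = n \<and> Q \<subseteq> X \<and> p \<notin> Q \<and> pairwise R (insert p Q)"
  proof (induction n)
    case 0
    have "pairwise R (insert p {})" by (simp only: pairwise_singleton)
    then show ?case by (intro exI[where x="{}"]) simp
  next
    case (Suc n)
    then obtain Q where Q: "finite Q" "card Q = n" "Q \<subseteq> X" "p \<notin> Q" "pairwise R (insert p Q)"
      by (elim exE conjE)
    have "finite (insert p Q)" "insert p Q \<subseteq> X"
      using Q p by auto
    then obtain y where y: "y \<in> X" "\<not> (\<exists>q\<in>insert p Q. \<exists>C. continuum C \<and> C \<subset> X \<and> q \<in> C \<and> y \<in> C)"
      by (rule composants_not_cover[OF X(1)])
    \<comment> \<open>The proper subcontinuum \<open>{y}\<close> shows that \<open>y\<close> differs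
      from all points chosen before.\<close>
    have "continuum {y}" "{y} \<subset> X"
      using X(2) y(1) p by (auto simp: continuum_def)
    then have yn: "y \<notin> insert p Q" using y(2) by blast
    have "\<forall>q\<in>insert p Q. R q y \<and> R y q"
      unfolding R_def using y(2) by blast
    then have "pairwise R (insert y (insert p Q))"
      using Q(5) by (subst pairwise_insert) blast
    moreover have "card (insert y Q) = Suc n" "p \<notin> insert y Q" "insert y Q \<subseteq> X" "finite (insert y Q)"
      using Q y(1) yn by auto
    ultimately show ?case
      by (intro exI[where x="insert y Q"]) (simp only: insert_commute simp_thms)
  qed
  then show thesis
    unfolding R_def by (elim exE conjE) (rule that)
qed

text \<open>Through \<open>q\<close> there are proper subcontinua reaching each \<open>B i\<close>,
  and a finite union of them stays proper by indecomposability. A proper subcontinuum meeting both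
  \<open>L q\<close> and \<open>L q'\<close> would unite with them to one joining \<open>q\<close>
  and \<open>q'\<close>, which lie in different composants.\<close>

lemma composant_continua:
  fixes X :: "'a::metric_space set"
  assumes X: "indecomposable X" "X \<noteq> {p}" and p: "p \<in> X"
    and I: "finite I" "\<forall>i\<in>I. open (B i) \<and> B i \<inter> X \<noteq> {}"
  obtains Q :: "'a set" and L where "finite Q" "card Q = n"
    "\<And>q. q \<in> Q \<Longrightarrow> continuum (L q)" "\<And>q. q \<in> Q \<Longrightarrow> L q \<subset> X" "\<And>q. q \<in> Q \<Longrightarrow> p \<notin> L q"
    "\<And>q i. q \<in> Q \<Longrightarrow> i \<in> I \<Longrightarrow> L q \<inter> B i \<noteq> {}"
    "\<And>q q' C. q \<in> Q \<Longrightarrow> q' \<in> Q \<Longrightarrow> q \<noteq> q' \<Longrightarrow> continuum C \<Longrightarrow> C \<subset> X \<Longrightarrow> C \<inter> L q = {} \<or> C \<inter> L q' = {}"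
proof -
  obtain Q where Q: "finite Q" "card Q = n" "Q \<subseteq> X" "p \<notin> Q" and
    sep: "pairwise (\<lambda>x y. \<not> (\<exists>C. continuum C \<and> C \<subset> X \<and> x \<in> C \<and> y \<in> C)) (insert p Q)"
    by (rule many_composants[OF X p, of n])
  have "\<exists>L. continuum L \<and> L \<subset> X \<and> q \<in> L \<and> (\<forall>i\<in>I. L \<inter> B i \<noteq> {})" if q: "q \<in> Q" for q
    using I
  proof (induction I rule: finite_induct)
    case empty
    have "continuum {q}" "{q} \<subset> X"
      using q Q(3,4) p by (auto simp: continuum_def)
    then show ?case by blast
  next
    case (insert i I)
    then obtain L where L: "continuum L" "L \<subset> X" "q \<in> L" "\<forall>i\<in>I. L \<inter> B i \<noteq> {}"
      by auto
    have "X \<noteq> {q}" "q \<in> X" "open (B i)" "B i \<inter> X \<noteq> {}"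
      using q Q(3,4) p insert.prems by auto
    then obtain C where C: "continuum C" "C \<subset> X" "q \<in> C" "C \<inter> B i \<noteq> {}"
      using composant_dense[OF X(1)] by metis
    have "continuum (L \<union> C)" using continuum_Un L C by blast
    moreover have "L \<union> C \<subset> X" using proper_subcontinua_Un[OF X(1)] L C by blast
    ultimately show ?case using L C by (intro exI[of _ "L \<union> C"]) auto
  qed
  then obtain L where L: "\<And>q. q \<in> Q \<Longrightarrow> continuum (L q) \<and> L q \<subset> X \<and> q \<in> L q \<and> (\<forall>i\<in>I. L q \<inter> B i \<noteq> {})"
    by metis
  have pL: "p \<notin> L q" if "q \<in> Q" for q
    using pairwiseD[OF sep, of p q] L[OF that] that Q(4) by blast
  have "C \<inter> L q = {} \<or> C \<inter> L q' = {}"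
    if qs: "q \<in> Q" "q' \<in> Q" "q \<noteq> q'" and C: "continuum C" "C \<subset> X" for q q' C
  proof (rule ccontr)
    assume "\<not> ?thesis"
    then have ne: "C \<inter> L q \<noteq> {}" "(C \<union> L q) \<inter> L q' \<noteq> {}" by auto
    have 1: "continuum (C \<union> L q)" "C \<union> L q \<subset> X"
      using C L[OF qs(1)] ne(1) continuum_Un proper_subcontinua_Un[OF X(1)] by metis+
    then have "continuum (C \<union> L q \<union> L q')" "C \<union> L q \<union> L q' \<subset> X"
      using L[OF qs(2)] ne(2) continuum_Un proper_subcontinua_Un[OF X(1)] by metis+
    then show False
      using pairwiseD[OF sep, of q q'] qs L[OF qs(1)] L[OF qs(2)] by blast
  qed
  then show thesis
    using pL L Q(1,2) by (intro that[of Q L]) simp_all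
qed

section \<open>Relations between continuous functions modulo exponentials\<close>

text \<open>Fraction-free Gaussian elimination, by induction on the equations: one equation removes
  one unknown.\<close>

lemma int_linear_dependence:
  fixes M :: "'e \<Rightarrow> 'j \<Rightarrow> int"
  assumes "finite E" "finite J" "card E < card J"
  shows "\<exists>a. (\<exists>j\<in>J. a j \<noteq> 0) \<and> (\<forall>e\<in>E. (\<Sum>j\<in>J. a j * M e j) = 0)"
  using assms
proof (induction E arbitrary: J M rule: finite_induct)
  case empty
  then have "J \<noteq> {}" by auto
  then show ?case by (intro exI[of _ "\<lambda>_. 1"]) auto
next
  case (insert e E)
  show ?case
  proof (cases "\<forall>j\<in>J. M e j = 0")
    case True
    obtain a where "\<exists>j\<in>J. a j \<noteq> 0" "\<forall>f\<in>E. (\<Sum>j\<in>J. a j * M f j) = 0"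
      using insert.IH[of J M] insert.prems insert.hyps by auto
    then show ?thesis using True by (intro exI[of _ a]) simp
  next
    case False
    then obtain k where k: "k \<in> J" "M e k \<noteq> 0" by blast
    let ?J = "J - {k}"
    have "card E < card ?J"
      using insert k by simp
    then obtain a where a: "\<exists>j\<in>?J. a j \<noteq> 0"
      "\<forall>f\<in>E. (\<Sum>j\<in>?J. a j * (M e k * M f j - M f k * M e j)) = 0"
      using insert.IH[of ?J "\<lambda>f j. M e k * M f j - M f k * M e j"] insert.prems by auto
    \<comment> \<open>The coefficient at the pivot \<open>k\<close> is chosen to satisfy equation
      \<open>e\<close>; scaling the others by \<open>M e k\<close> replaces a division.\<close>
    define b where "b j = (if j = k then - (\<Sum>j\<in>?J. a j * M e j) else M e k * a j)" for j
    have b: "(\<Sum>j\<in>J. b j * M f j) = (\<Sum>j\<in>?J. a j * (M e k * M f j - M f k * M e j))" for f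
    proof -
      have "(\<Sum>j\<in>J. b j * M f j) = b k * M f k + (\<Sum>j\<in>?J. b j * M f j)"
        using insert.prems(1) k(1) by (rule sum.remove)
      also have "(\<Sum>j\<in>?J. b j * M f j) = (\<Sum>j\<in>?J. M e k * a j * M f j)"
        by (rule sum.cong) (auto simp: b_def)
      moreover have "(\<Sum>j\<in>?J. a j * M e j) * M f k = (\<Sum>j\<in>?J. a j * (M f k * M e j))"
        unfolding sum_distrib_right by (rule sum.cong) auto
      then have "b k * M f k = - (\<Sum>j\<in>?J. a j * (M f k * M e j))"
        by (simp only: b_def if_True refl minus_mult_left[symmetric])
      moreover have "(\<Sum>j\<in>?J. a j * (M e k * M f j - M f k * M e j)) =
          (\<Sum>j\<in>?J. M e k * a j * M f j) - (\<Sum>j\<in>?J. a j * (M f k * M e j))"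
        unfolding sum_subtractf[symmetric] by (rule sum.cong) (auto simp: right_diff_distrib)
      ultimately show ?thesis by linarith
    qed
    have "\<exists>j\<in>J. b j \<noteq> 0" using a(1) k(2) by (auto simp: b_def)
    moreover have "(\<Sum>j\<in>J. b j * M f j) = 0" if "f \<in> insert e E" for f
    proof (cases "f = e")
      case True
      then show ?thesis unfolding b[of f] by simp
    next
      case False
      then have "f \<in> E" using that by blast
      then show ?thesis unfolding b[of f] by (rule bspec[OF a(2)])
    qed
    ultimately show ?thesis by (intro exI[of _ b] conjI ballI)
  qed
qed

text \<open>The values lie in the discrete set of integer multiples of \<open>2 * pi * \<i>\<close>,
  and a continuous function on a connected set cannot jump between them.\<close>

lemma connected_exp_eq_1_constant:
  fixes f :: "'a::topological_space \<Rightarrow> complex"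
  assumes "connected C" "continuous_on C f" "\<And>x. x \<in> C \<Longrightarrow> exp (f x) = 1"
  shows "f constant_on C"
proof (rule continuous_discrete_range_constant[OF assms(1,2)])
  fix x assume x: "x \<in> C"
  have "1 \<le> norm (f y - f x)" if y: "y \<in> C" "f y \<noteq> f x" for y
  proof -
    have "exp (f y) = exp (f x)" using assms(3) x y(1) by simp
    then obtain n :: int where n: "f y = f x + of_int (2 * n) * of_real pi * \<i>"
      unfolding exp_eq by auto
    then have "n \<noteq> 0" using y(2) by auto
    then have "1 \<le> \<bar>real_of_int n\<bar>" by linarith
    then have "1 * 2 \<le> \<bar>real_of_int n\<bar> * (2 * pi)"
      using pi_gt3 by (intro mult_mono) auto
    then show ?thesis using n by (simp add: norm_mult algebra_simps)
  qed
  then show "\<exists>e>0. \<forall>y. y \<in> C \<and> f y \<noteq> f x \<longrightarrow> e \<le> norm (f y - f x)"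
    by (intro exI[of _ 1]) auto
qed

lemma connected_exp_eq_1:
  fixes f :: "'a::topological_space \<Rightarrow> complex"
  assumes "connected C" "continuous_on C f" "\<And>x. x \<in> C \<Longrightarrow> exp (f x) = 1"
  shows "\<exists>n::int. \<forall>x\<in>C. f x = of_int n * (2 * of_real pi * \<i>)"
proof (cases "C = {}")
  case False
  then obtain x where x: "x \<in> C" by blast
  have "exp (f x) = exp 0" using assms(3)[OF x] by simp
  then obtain n :: int where "f x = of_int n * (2 * of_real pi * \<i>)"
    unfolding exp_eq by (auto simp: algebra_simps)
  moreover obtain z where "\<And>y. y \<in> C \<Longrightarrow> f y = z"
    using connected_exp_eq_1_constant[OF assms] by (auto simp: constant_on_def)
  ultimately show ?thesis using x by auto
qed auto

text \<open>An elementary substitute for the vanishing of first integral cohomology, whose classes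
  on a metric space are represented by maps to the punctured plane modulo exponentials.\<close>

definition has_logarithms :: "'a::topological_space set \<Rightarrow> bool" where
  "has_logarithms W \<longleftrightarrow> (\<forall>f :: 'a \<Rightarrow> complex. continuous_on W f \<longrightarrow> (\<forall>x\<in>W. f x \<noteq> 0) \<longrightarrow>
     (\<exists>g. continuous_on W g \<and> (\<forall>x\<in>W. f x = exp (g x))))"

text \<open>On each component of an overlap \<open>W a \<inter> W b\<close>, two local logarithms differ by a constant multiple of
  \<open>2\<pi>i\<close>. Only finitely many of these multiples matter for gluing over the closed cover \<open>K\<close>, and
  integer linear algebra makes all of them vanish.\<close>

lemma exists_log_relations:
  fixes Y :: "'a::metric_space set" and W K :: "'c \<Rightarrow> 'a set"
  assumes A: "finite A" and cov: "Y = (\<Union>a\<in>A. W a)" "Y = (\<Union>a\<in>A. K a)"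
    and KW: "\<And>a. a \<in> A \<Longrightarrow> K a \<subseteq> W a"
    and clo: "\<And>a. a \<in> A \<Longrightarrow> closedin (top_of_set Y) (K a)"
    and log: "\<And>a. a \<in> A \<Longrightarrow> has_logarithms (W a)"
    and fin: "\<And>a b. a \<in> A \<Longrightarrow> b \<in> A \<Longrightarrow> finite {c \<in> components (W a \<inter> W b). c \<inter> (K a \<inter> K b) \<noteq> {}}"
  shows "\<exists>N. \<forall>(I::'i set) (J::'j set) (\<theta> :: 'i \<Rightarrow> 'j \<Rightarrow> 'a \<Rightarrow> complex).
    finite I \<longrightarrow> finite J \<longrightarrow> card I * N < card J \<longrightarrow>
    (\<forall>i\<in>I. \<forall>j\<in>J. continuous_on Y (\<theta> i j) \<and> (\<forall>x\<in>Y. \<theta> i j x \<noteq> 0)) \<longrightarrow>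
    (\<exists>\<alpha>::'j \<Rightarrow> int. (\<exists>j\<in>J. \<alpha> j \<noteq> 0) \<and>
      (\<forall>i\<in>I. \<exists>G. continuous_on Y G \<and> (\<forall>x\<in>Y. exp (G x) = (\<Prod>j\<in>J. \<theta> i j x powi \<alpha> j))))"
proof -
  define \<Gamma> where "\<Gamma> = (SIGMA ab:A \<times> A. {c \<in> components (W (fst ab) \<inter> W (snd ab)). c \<inter> (K (fst ab) \<inter> K (snd ab)) \<noteq> {}})"
  have fin\<Gamma>: "finite \<Gamma>"
    unfolding \<Gamma>_def using A fin by (intro finite_SigmaI) auto
  show ?thesis
  \<comment> \<open>Each \<open>i\<close> and each overlap component recorded in
    \<open>\<Gamma>\<close> give one integer equation for the exponents \<open>\<alpha>\<close>;
    more unknowns than equations force a nonzero solution.\<close>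
  proof (intro exI[of _ "card \<Gamma>"] allI impI)
    fix I :: "'i set" and J :: "'j set" and \<theta> :: "'i \<Rightarrow> 'j \<Rightarrow> 'a \<Rightarrow> complex"
    assume I: "finite I" and J: "finite J" and card: "card I * card \<Gamma> < card J"
      and \<theta>: "\<forall>i\<in>I. \<forall>j\<in>J. continuous_on Y (\<theta> i j) \<and> (\<forall>x\<in>Y. \<theta> i j x \<noteq> 0)"
    have "\<exists>g. continuous_on (W a) g \<and> (\<forall>x\<in>W a. \<theta> i j x = exp (g x))"
      if "i \<in> I" "j \<in> J" "a \<in> A" for i j a
    proof -
      have "W a \<subseteq> Y" using cov that by blast
      then have "continuous_on (W a) (\<theta> i j)" "\<forall>x\<in>W a. \<theta> i j x \<noteq> 0"
        using \<theta> that by (auto intro: continuous_on_subset)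
      then show ?thesis using log[OF that(3)] unfolding has_logarithms_def by blast
    qed
    then obtain g where g: "\<And>i j a. i \<in> I \<Longrightarrow> j \<in> J \<Longrightarrow> a \<in> A \<Longrightarrow> continuous_on (W a) (g i j a)"
      "\<And>i j a x. i \<in> I \<Longrightarrow> j \<in> J \<Longrightarrow> a \<in> A \<Longrightarrow> x \<in> W a \<Longrightarrow> \<theta> i j x = exp (g i j a x)"
      by metis
    have ex: "\<exists>n::int. \<forall>x\<in>c. g i j a x - g i j b x = of_int n * (2 * of_real pi * \<i>)"
      if "i \<in> I" "j \<in> J" "((a, b), c) \<in> \<Gamma>" for i j a b c
    proof (rule connected_exp_eq_1)
      have ab: "a \<in> A" "b \<in> A" "c \<in> components (W a \<inter> W b)"
        using that by (auto simp: \<Gamma>_def)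
      then have c: "c \<subseteq> W a" "c \<subseteq> W b" using in_components_subset by blast+
      show "connected c" using ab in_components_connected by blast
      show "continuous_on c (\<lambda>x. g i j a x - g i j b x)"
        using g(1)[OF that(1,2) ab(1)] g(1)[OF that(1,2) ab(2)] c
        by (auto intro!: continuous_on_diff intro: continuous_on_subset)
      show "exp (g i j a x - g i j b x) = 1" if "x \<in> c" for x
      proof -
        have "x \<in> W a" "x \<in> W b" using c that by auto
        then have "exp (g i j a x) = exp (g i j b x)"
          using g(2)[OF \<open>i \<in> I\<close> \<open>j \<in> J\<close> ab(1), of x] g(2)[OF \<open>i \<in> I\<close> \<open>j \<in> J\<close> ab(2), of x] by simp
        then show ?thesis by (simp add: exp_diff)
      qed
    qed
    define n where "n i j e = (SOME n::int. \<forall>x\<in>snd e. g i j (fst (fst e)) x - g i j (snd (fst e)) x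
        = of_int n * (2 * of_real pi * \<i>))" for i j e
    have n: "g i j a x - g i j b x = of_int (n i j ((a, b), c)) * (2 * of_real pi * \<i>)"
      if "i \<in> I" "j \<in> J" "((a, b), c) \<in> \<Gamma>" "x \<in> c" for i j a b c x
      unfolding n_def fst_conv snd_conv by (rule bspec[OF someI_ex[OF ex[OF that(1-3)]] that(4)])
    have "finite (I \<times> \<Gamma>)" "card (I \<times> \<Gamma>) < card J"
      using I fin\<Gamma> card by (simp_all add: card_cartesian_product)
    then obtain \<alpha> where \<alpha>: "\<exists>j\<in>J. \<alpha> j \<noteq> 0"
      "\<forall>e\<in>I \<times> \<Gamma>. (\<Sum>j\<in>J. \<alpha> j * n (fst e) j (snd e)) = 0"
      using int_linear_dependence[of "I \<times> \<Gamma>" J "\<lambda>e j. n (fst e) j (snd e)"] J by blast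
    have "\<exists>G. continuous_on Y G \<and> (\<forall>x\<in>Y. exp (G x) = (\<Prod>j\<in>J. \<theta> i j x powi \<alpha> j))" if i: "i \<in> I" for i
    proof -
      \<comment> \<open>Local logarithms of the product. The equations for \<open>\<alpha>\<close>
        cancel their jumps on the recorded components, which contain all points of
        \<open>K a \<inter> K b\<close>; this is what pasting over the closed cover \<open>K\<close>
        asks for.\<close>
      define F where "F a x = (\<Sum>j\<in>J. of_int (\<alpha> j) * g i j a x)" for a x
      have contF: "continuous_on (W a) (F a)" if "a \<in> A" for a
        unfolding F_def using g(1)[OF i _ that] by (intro continuous_intros) auto
      have agree: "F a x = F b x" if ab: "a \<in> A" "b \<in> A" and x: "x \<in> K a" "x \<in> K b" for a b x
      proof -
        have "x \<in> W a \<inter> W b" using KW ab x by blast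
        then obtain c where c: "c \<in> components (W a \<inter> W b)" "x \<in> c"
          by (metis Union_components UnionE)
        then have \<Gamma>: "((a, b), c) \<in> \<Gamma>" using ab x by (auto simp: \<Gamma>_def)
        have "F a x - F b x = (\<Sum>j\<in>J. of_int (\<alpha> j) * (g i j a x - g i j b x))"
          by (simp add: F_def sum_subtractf right_diff_distrib)
        also have "\<dots> = (\<Sum>j\<in>J. of_int (\<alpha> j * n i j ((a, b), c)) * (2 * of_real pi * \<i>))"
          using n[OF i _ \<Gamma> c(2)] by (intro sum.cong) auto
        also have "\<dots> = of_int (\<Sum>j\<in>J. \<alpha> j * n i j ((a, b), c)) * (2 * of_real pi * \<i>)"
          by (simp add: sum_distrib_right)
        also have "(\<Sum>j\<in>J. \<alpha> j * n i j ((a, b), c)) = 0"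
          using \<alpha>(2) i \<Gamma> by auto
        finally show ?thesis by simp
      qed
      obtain G where G: "continuous_map (top_of_set Y) euclidean G"
        "\<And>x a. a \<in> A \<Longrightarrow> x \<in> topspace (top_of_set Y) \<inter> K a \<Longrightarrow> G x = F a x"
      proof (rule pasting_lemma_exists_closed[OF A, of "top_of_set Y" K euclidean F])
        show "topspace (top_of_set Y) \<subseteq> \<Union> (K ` A)" using cov by simp
        show "continuous_map (subtopology (top_of_set Y) (K a)) euclidean (F a)" if "a \<in> A" for a
        proof -
          have "K a \<subseteq> Y" using cov(2) that by blast
          then have "subtopology (top_of_set Y) (K a) = top_of_set (K a)"
            by (simp add: subtopology_subtopology Int_absorb1)
          then show ?thesis using continuous_on_subset[OF contF[OF that] KW[OF that]] by simp
        qed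
        show "F a x = F b x" if "a \<in> A" "b \<in> A" "x \<in> topspace (top_of_set Y) \<inter> K a \<inter> K b" for a b x
          using agree[OF that(1,2)] that(3) by simp
      qed (use clo in simp_all)
      have "exp (G x) = (\<Prod>j\<in>J. \<theta> i j x powi \<alpha> j)" if x: "x \<in> Y" for x
      proof -
        obtain a where a: "a \<in> A" "x \<in> K a" using cov(2) x by blast
        then have "exp (G x) = exp (F a x)" using G(2) x by simp
        also have "\<dots> = (\<Prod>j\<in>J. exp (g i j a x) powi \<alpha> j)"
          unfolding F_def using J by (simp add: exp_sum exp_power_int)
        also have "\<dots> = (\<Prod>j\<in>J. \<theta> i j x powi \<alpha> j)"
          using g(2)[OF i _ a(1)] KW[OF a(1)] a(2) by (intro prod.cong) auto
        finally show ?thesis .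
      qed
      moreover have "continuous_on Y G" using G(1) by simp
      ultimately show ?thesis by blast
    qed
    then show "\<exists>\<alpha>::'j \<Rightarrow> int. (\<exists>j\<in>J. \<alpha> j \<noteq> 0) \<and>
      (\<forall>i\<in>I. \<exists>G. continuous_on Y G \<and> (\<forall>x\<in>Y. exp (G x) = (\<Prod>j\<in>J. \<theta> i j x powi \<alpha> j)))"
      using \<alpha>(1) by blast
  qed
qed

section \<open>Punctured closed surfaces\<close>

text \<open>Pulled back to the convex set, a nonvanishing function has a logarithm by
  contractibility, and \<open>g\<close> carries it back. Discs and half planes in charts are the
  intended cases.\<close>

lemma has_logarithms_homeomorphic_image:
  fixes f :: "'b::real_normed_vector \<Rightarrow> 'a::topological_space"
  assumes hom: "homeomorphism T U f g" and C: "convex C" "C \<subseteq> T"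
  shows "has_logarithms (f ` C)"
  unfolding has_logarithms_def
proof (intro allI impI)
  fix h :: "'a \<Rightarrow> complex"
  assume h: "continuous_on (f ` C) h" "\<forall>x\<in>f ` C. h x \<noteq> 0"
  have hom': "homeomorphism C (f ` C) f g"
    by (rule homeomorphism_of_subsets[OF hom C(2)]) (use hom C in \<open>auto simp: homeomorphism_def\<close>)
  then have "continuous_on C (h \<circ> f)"
    using h(1) by (intro continuous_on_compose) (auto simp: homeomorphism_def)
  moreover have "contractible C" using C(1) by (rule convex_imp_contractible)
  ultimately obtain k where k: "continuous_on C k" "\<And>x. x \<in> C \<Longrightarrow> (h \<circ> f) x = exp (k x)"
    using continuous_logarithm_on_contractible[of C "h \<circ> f"] h(2) by auto
  have gf: "g ` f ` C = C" "\<And>x. x \<in> C \<Longrightarrow> g (f x) = x"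
    using hom' by (auto simp: homeomorphism_def)
  have "continuous_on (f ` C) (k \<circ> g)"
    using hom' k(1) gf(1) by (intro continuous_on_compose) (auto simp: homeomorphism_def)
  moreover have "\<forall>x\<in>f ` C. h x = exp ((k \<circ> g) x)"
    using k(2) gf(2) by auto
  ultimately show "\<exists>g. continuous_on (f ` C) g \<and> (\<forall>x\<in>f ` C. h x = exp (g x))"
    by blast
qed

text \<open>The components of \<open>W\<close> are open in \<open>W\<close> and disjoint, so a
  finite subcover of \<open>K\<close> must contain every component that meets
  \<open>K\<close>.\<close>

lemma finite_components_meeting_compact:
  fixes W :: "'a::metric_space set"
  assumes W: "locally connected W" and K: "compact K" "K \<subseteq> W"
  shows "finite {c \<in> components W. c \<inter> K \<noteq> {}}"
proof -
  have "\<forall>c \<in> (\<lambda>c. K \<inter> c) ` components W. openin (top_of_set K) c"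
  proof clarify
    fix c assume "c \<in> components W"
    then obtain O' where "open O'" "c = W \<inter> O'"
      using openin_components_locally_connected[OF W] by (meson openin_open)
    then have "open O'" "K \<inter> c = K \<inter> O'" using K(2) by auto
    then show "openin (top_of_set K) (K \<inter> c)" by (simp add: openin_open_Int)
  qed
  moreover have "K \<subseteq> \<Union> ((\<lambda>c. K \<inter> c) ` components W)"
    using K(2) Union_components[of W] by blast
  ultimately obtain D where D: "D \<subseteq> (\<lambda>c. K \<inter> c) ` components W" "finite D" "K \<subseteq> \<Union>D"
    using K(1) unfolding compact_eq_openin_cover by meson
  then obtain E where E: "E \<subseteq> components W" "finite E" "D = (\<lambda>c. K \<inter> c) ` E"
    using finite_subset_image[OF D(2,1)] by metis
  have "{c \<in> components W. c \<inter> K \<noteq> {}} \<subseteq> E"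
  proof
    fix c assume "c \<in> {c \<in> components W. c \<inter> K \<noteq> {}}"
    then obtain x where c: "c \<in> components W" and x: "x \<in> c" "x \<in> K" by blast
    obtain d where d: "d \<in> E" "x \<in> d" using D(3) E(3) x(2) by blast
    then have "c = d" using components_nonoverlap[OF c, of d] E(1) x(1) by blast
    then show "c \<in> E" using d(1) by simp
  qed
  then show ?thesis using E(2) finite_subset by blast
qed

text \<open>A translation of the plane normalises the chart, so that discs about the origin give
  neighbourhoods of \<open>x\<close>.\<close>

lemma closed_surface_chart:
  assumes S: "closed_surface S" and x: "x \<in> S"
  obtains f :: "real^2 \<Rightarrow> 'a::metric_space" and g U where
    "openin (top_of_set S) U" "homeomorphism UNIV U f g" "f 0 = x"
proof -
  have "\<forall>x\<in>S. \<exists>U. openin (top_of_set S) U \<and> x \<in> U \<and> U homeomorphic (UNIV :: (real^2) set)"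
    using S unfolding closed_surface_def by (elim conjE)
  then obtain U where U: "openin (top_of_set S) U" "x \<in> U" "U homeomorphic (UNIV :: (real^2) set)"
    using x by (elim ballE[where x=x] exE conjE) simp_all
  then obtain g and f :: "real^2 \<Rightarrow> 'a" where "homeomorphism U UNIV g f"
    unfolding homeomorphic_def by (elim exE)
  then have fg: "homeomorphism UNIV U f g" by (rule homeomorphism_symD)
  have 1: "homeomorphism UNIV UNIV (\<lambda>y. g x + y) (\<lambda>y. y - g x)"
  proof (rule homeomorphismI)
    show "continuous_on UNIV (\<lambda>y. g x + y)" "continuous_on UNIV (\<lambda>y. y - g x)"
      by (intro continuous_intros)+
    show "(\<lambda>y. g x + y) ` UNIV \<subseteq> UNIV" "(\<lambda>y. y - g x) ` UNIV \<subseteq> UNIV"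
      by (rule subset_UNIV)+
  qed simp_all
  show thesis
  proof (rule that[OF U(1)])
    show "homeomorphism UNIV U (f \<circ> (\<lambda>y. g x + y)) ((\<lambda>y. y - g x) \<circ> g)"
      by (rule homeomorphism_compose[OF 1 fg])
    show "(f \<circ> (\<lambda>y. g x + y)) 0 = x"
      using fg U(2) by (simp add: homeomorphism_def)
  qed
qed

section \<open>Images of discs under charts\<close>

lemma chart_image_openin:
  assumes "openin (top_of_set S) U" "homeomorphism UNIV U f g" "open C"
  shows "openin (top_of_set S) (f ` C)"
proof -
  have "openin (top_of_set U) (f ` C)"
    using homeomorphism_imp_open_map[OF assms(2), of C] assms(3) by simp
  then show ?thesis using assms(1) openin_trans by blast
qed

lemma chart_image_compact:
  assumes "homeomorphism UNIV U f g" "compact C"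
  shows "compact (f ` C)"
  using assms by (meson compact_continuous_image continuous_on_subset homeomorphism_def subset_UNIV)

text \<open>Small discs in a chart are connected neighbourhoods. This makes complementary domains
  open in \<open>S\<close> and components of overlaps open.\<close>

lemma closed_surface_locally_connected:
  assumes S: "closed_surface S"
  shows "locally connected S"
  unfolding locally_connected
proof (intro allI impI)
  fix v x assume v: "openin (top_of_set S) v \<and> x \<in> v"
  then have "x \<in> S" using openin_imp_subset by blast
  then obtain f :: "real^2 \<Rightarrow> 'a" and g U where U: "openin (top_of_set S) U"
    and fg: "homeomorphism UNIV U f g" and f0: "f 0 = x"
    by (rule closed_surface_chart[OF S])
  have cf: "continuous_on UNIV f" "f ` UNIV = U" using fg by (auto simp: homeomorphism_def)
  have US: "U \<subseteq> S" using U openin_imp_subset by blast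
  obtain O' where O': "open O'" "v = S \<inter> O'" using v by (meson openin_open)
  have "open (f -` O')" using O'(1) cf(1) open_vimage by blast
  moreover have "0 \<in> f -` O'" using O'(2) v f0 by simp
  ultimately obtain e where e: "e > 0" "ball 0 e \<subseteq> f -` O'" using open_contains_ball by blast
  have "openin (top_of_set S) (f ` ball 0 e)"
    by (rule chart_image_openin[OF U fg]) simp
  moreover have "connected (f ` ball 0 e)"
    using cf(1) by (intro connected_continuous_image) (auto intro: continuous_on_subset)
  moreover have "x \<in> f ` ball 0 e" using f0 e(1) by force
  moreover have "f ` ball 0 e \<subseteq> v" using e(2) O'(2) cf(2) US by blast
  ultimately show "\<exists>u. openin (top_of_set S) u \<and> connected u \<and> x \<in> u \<and> u \<subseteq> v" by blast
qed

text \<open>Three concentric discs with separate roles: \<open>V\<close> is open for extracting a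
  finite subcover, \<open>K\<close> supplies the compact pieces for gluing, and \<open>W\<close>
  carries the logarithms.\<close>

lemma closed_surface_cell:
  assumes S: "closed_surface S" and x: "x \<in> S" "x \<noteq> p"
  shows "\<exists>W K V. openin (top_of_set S) V \<and> x \<in> V \<and> V \<subseteq> K \<and> compact K \<and> K \<subseteq> W \<and>
    openin (top_of_set S) W \<and> p \<notin> W \<and> has_logarithms W"
proof -
  obtain f :: "real^2 \<Rightarrow> 'a" and g U where U: "openin (top_of_set S) U"
    and fg: "homeomorphism UNIV U f g" and f0: "f 0 = x"
    using closed_surface_chart[OF S x(1)] by metis
  \<comment> \<open>If the chart covers \<open>p\<close>, the open disc reaching exactly up to
    \<open>g p\<close> omits it; otherwise any radius works.\<close>
  obtain r where r: "r > 0" "p \<notin> f ` ball 0 r"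
  proof (cases "p \<in> U")
    case True
    then have "f (g p) = p" using fg by (simp add: homeomorphism_def)
    then have "g p \<noteq> 0" using f0 x(2) by auto
    moreover have "p \<notin> f ` ball 0 (norm (g p))"
      using fg by (auto simp: homeomorphism_def)
    ultimately show thesis using that[of "norm (g p)"] by simp
  next
    case False
    then have "p \<notin> f ` ball 0 1" using fg by (auto simp: homeomorphism_def)
    then show thesis using that[of 1] by simp
  qed
  show ?thesis
  proof (intro exI conjI)
    show "openin (top_of_set S) (f ` ball 0 (r/2))" "openin (top_of_set S) (f ` ball 0 r)"
      by (rule chart_image_openin[OF U fg]; simp)+
    show "x \<in> f ` ball 0 (r/2)" using f0 r(1) by force
    show "f ` ball 0 (r/2) \<subseteq> f ` cball 0 (r/2)" "f ` cball 0 (r/2) \<subseteq> f ` ball 0 r"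
      using r(1) by (intro image_mono; force)+
    show "compact (f ` cball 0 (r/2))" by (rule chart_image_compact[OF fg]) simp
    show "has_logarithms (f ` ball 0 r)"
      by (rule has_logarithms_homeomorphic_image[OF fg]) auto
  qed (rule r(2))
qed

text \<open>The norm is at most the sum of the absolute coordinates, so some coordinate has at least
  the average size. In the plane, the four resulting cones cover everything.\<close>

lemma exists_large_coordinate:
  fixes y :: "'b::euclidean_space"
  shows "\<exists>v \<in> Basis \<union> uminus ` Basis. norm y \<le> DIM('b) * (y \<bullet> v)"
proof (rule ccontr)
  assume neg: "\<not> ?thesis"
  have "norm y \<le> (\<Sum>b\<in>Basis. \<bar>y \<bullet> b\<bar>)" by (rule norm_le_l1)
  also have "\<dots> < (\<Sum>b\<in>(Basis::'b set). norm y / DIM('b))"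
  proof (rule sum_strict_mono)
    fix b :: 'b assume "b \<in> Basis"
    then have "b \<in> Basis \<union> uminus ` Basis" "- b \<in> Basis \<union> uminus ` Basis" by simp_all
    then have "\<not> norm y \<le> DIM('b) * (y \<bullet> b)" "\<not> norm y \<le> DIM('b) * (y \<bullet> (- b))"
      using neg by blast+
    then show "\<bar>y \<bullet> b\<bar> < norm y / DIM('b)"
      by (simp add: field_simps abs_if)
  qed auto
  finally show False by simp
qed

text \<open>Near the puncture, the surface is covered by the images of finitely many half planes, on which
  the points of large coordinate form cones that are closed away from the puncture.\<close>

lemma punctured_surface_log_relations:
  assumes S: "closed_surface S" and p: "p \<in> S" and Y: "Y = S - {p}"
  shows "\<exists>N. \<forall>(I::'i set) (J::'j set) (\<theta> :: 'i \<Rightarrow> 'j \<Rightarrow> 'a::metric_space \<Rightarrow> complex).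
    finite I \<longrightarrow> finite J \<longrightarrow> card I * N < card J \<longrightarrow>
    (\<forall>i\<in>I. \<forall>j\<in>J. continuous_on Y (\<theta> i j) \<and> (\<forall>x\<in>Y. \<theta> i j x \<noteq> 0)) \<longrightarrow>
    (\<exists>\<alpha>::'j \<Rightarrow> int. (\<exists>j\<in>J. \<alpha> j \<noteq> 0) \<and>
      (\<forall>i\<in>I. \<exists>G. continuous_on Y G \<and> (\<forall>x\<in>Y. exp (G x) = (\<Prod>j\<in>J. \<theta> i j x powi \<alpha> j))))"
proof -
  have compS: "compact S" using S by (simp add: closed_surface_def)
  have lc: "locally connected S" by (rule closed_surface_locally_connected[OF S])
  obtain f :: "real^2 \<Rightarrow> 'a" and g U where U: "openin (top_of_set S) U"
    and fg: "homeomorphism UNIV U f g" and f0: "f 0 = p"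
    using closed_surface_chart[OF S p] by metis
  have inj: "inj f" using fg by (metis UNIV_I homeomorphism_def injI)
  have fp: "f y = p \<longleftrightarrow> y = 0" for y using inj f0 by (metis injD)
  define V where "V = (Basis \<union> uminus ` Basis :: (real^2) set)"
  \<comment> \<open>The open half plane \<open>H v\<close> avoids the origin, the preimage of
    \<open>p\<close>, while the truncated closed cone \<open>Cn v\<close> contains it. The factor 2
    is the dimension of the plane.\<close>
  define H where "H v = {y::real^2. 0 < y \<bullet> v}" for v
  define Cn where "Cn v = {y::real^2. norm y \<le> 2 * (y \<bullet> v)} \<inter> cball 0 1" for v
  have finV: "finite V" by (simp add: V_def)
  have compCn: "compact (f ` Cn v)" for v
    unfolding Cn_def
    by (intro chart_image_compact[OF fg] closed_Int_compact closed_Collect_le continuous_intros) auto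
  have CnH: "Cn v - {0} \<subseteq> H v" for v
  proof
    fix y assume "y \<in> Cn v - {0}"
    then have "norm y \<le> 2 * (y \<bullet> v)" "0 < norm y" by (auto simp: Cn_def)
    then have "0 < y \<bullet> v" by linarith
    then show "y \<in> H v" by (simp add: H_def)
  qed
  have convH: "convex (H v)" for v
    unfolding H_def using convex_halfspace_gt[of 0 v] by (simp add: inner_commute)
  have opH: "open (H v)" for v
    unfolding H_def by (intro open_Collect_less continuous_intros)
  define P where "P WKV \<longleftrightarrow> (case WKV of (W, K, V) \<Rightarrow> openin (top_of_set S) V \<and> V \<subseteq> K \<and> compact K \<and> K \<subseteq> W \<and>
    openin (top_of_set S) W \<and> p \<notin> W \<and> has_logarithms W)" for WKV :: "'a set \<times> 'a set \<times> 'a set"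
  \<comment> \<open>The compact remainder outside the disc about \<open>p\<close> needs only
    finitely many cells.\<close>
  define S' where "S' = S - f ` ball 0 1"
  have "openin (top_of_set S) (f ` ball 0 1)"
    by (rule chart_image_openin[OF U fg]) simp
  then have compS': "compact S'"
    unfolding S'_def using compS by (metis closedin_compact closedin_diff closedin_subtopology_refl topspace_euclidean_subtopology closedin_topspace)
  have "\<exists>z. P z \<and> x \<in> snd (snd z)" if "x \<in> S'" for x
  proof -
    have "x \<in> S" "x \<noteq> p" using that f0 by (auto simp: S'_def)
    from closed_surface_cell[OF S this] show ?thesis unfolding P_def by auto
  qed
  then obtain z where z: "\<And>x. x \<in> S' \<Longrightarrow> P (z x)" "\<And>x. x \<in> S' \<Longrightarrow> x \<in> snd (snd (z x))"
    by metis
  have "\<forall>c \<in> (\<lambda>x. S' \<inter> snd (snd (z x))) ` S'. openin (top_of_set S') c"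
  proof clarify
    fix x assume "x \<in> S'"
    then have "openin (top_of_set S) (snd (snd (z x)))" using z(1)[of x] by (auto simp: P_def split: prod.splits)
    then obtain O' where O': "open O'" "snd (snd (z x)) = S \<inter> O'" by (meson openin_open)
    then have "S' \<inter> snd (snd (z x)) = S' \<inter> O'" by (auto simp: S'_def)
    then show "openin (top_of_set S') (S' \<inter> snd (snd (z x)))" using O'(1) by (simp add: openin_open_Int)
  qed
  moreover have "S' \<subseteq> \<Union> ((\<lambda>x. S' \<inter> snd (snd (z x))) ` S')" using z(2) by blast
  ultimately obtain D where D: "D \<subseteq> (\<lambda>x. S' \<inter> snd (snd (z x))) ` S'" "finite D" "S' \<subseteq> \<Union>D"
    using compS' unfolding compact_eq_openin_cover by meson
  then obtain F where F: "F \<subseteq> S'" "finite F" "D = (\<lambda>x. S' \<inter> snd (snd (z x))) ` F"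
    by (meson finite_subset_image)
  \<comment> \<open>\<open>Inl\<close> indexes the half planes at the puncture, \<open>Inr\<close>
    the cells covering \<open>S'\<close>. Removing \<open>p\<close> from the cones leaves sets
    closed in \<open>Y\<close> but not compact.\<close>
  define A where "A = Inl ` V \<union> Inr ` F"
  define W where "W = case_sum (\<lambda>v. f ` H v) (\<lambda>x. fst (z x))"
  define K where "K = case_sum (\<lambda>v. f ` Cn v - {p}) (\<lambda>x. fst (snd (z x)))"
  have zF: "P (z x)" if "x \<in> F" for x using z(1) F(1) that by blast
  have WR: "openin (top_of_set S) (W (Inr x))" "p \<notin> W (Inr x)" "has_logarithms (W (Inr x))"
    "K (Inr x) \<subseteq> W (Inr x)" "compact (K (Inr x))" "snd (snd (z x)) \<subseteq> K (Inr x)" if "x \<in> F" for x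
    using zF[OF that] by (auto simp: P_def W_def K_def split: prod.splits)
  have WL: "openin (top_of_set S) (W (Inl v))" "p \<notin> W (Inl v)" "has_logarithms (W (Inl v))"
    "K (Inl v) \<subseteq> W (Inl v)" for v
  proof -
    show "openin (top_of_set S) (W (Inl v))"
      using chart_image_openin[OF U fg opH] by (simp add: W_def)
    have "0 \<notin> H v" by (simp add: H_def)
    then show "p \<notin> W (Inl v)" unfolding W_def sum.case using fp by (metis imageE)
    show "has_logarithms (W (Inl v))"
      using has_logarithms_homeomorphic_image[OF fg convH] by (simp add: W_def)
    have "f ` Cn v - {p} \<subseteq> f ` (Cn v - {0})" using f0 by auto
    also have "\<dots> \<subseteq> f ` H v" using CnH by (rule image_mono)
    finally show "K (Inl v) \<subseteq> W (Inl v)" by (simp add: K_def W_def)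
  qed
  have Wsub: "W a \<subseteq> Y" and KW: "K a \<subseteq> W a" and logW: "has_logarithms (W a)"
    and openW: "openin (top_of_set S) (W a)" if "a \<in> A" for a
  proof -
    have "(\<exists>v. a = Inl v) \<or> (\<exists>x\<in>F. a = Inr x)" using that by (auto simp: A_def)
    then have *: "openin (top_of_set S) (W a)" "K a \<subseteq> W a" "has_logarithms (W a)" "p \<notin> W a"
      using WL WR(1-4) by metis+
    show "openin (top_of_set S) (W a)" "K a \<subseteq> W a" "has_logarithms (W a)" by (fact *)+
    show "W a \<subseteq> Y" using openin_imp_subset[OF *(1)] *(4) Y by blast
  qed
  have covK: "Y \<subseteq> (\<Union>a\<in>A. K a)"
  proof
    fix x assume x: "x \<in> Y"
    show "x \<in> (\<Union>a\<in>A. K a)"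
    proof (cases "x \<in> S'")
      case True
      then obtain y where "y \<in> F" "x \<in> snd (snd (z y))" using D(3) F(3) by blast
      then show ?thesis using WR(6)[of y] unfolding A_def by blast
    next
      case False
      then obtain y where y: "x = f y" "norm y < 1" using x Y by (auto simp: S'_def)
      obtain v where v: "v \<in> V" "norm y \<le> 2 * (y \<bullet> v)"
        using exists_large_coordinate[of y] by (auto simp: V_def)
      have "x \<in> K (Inl v)" using y v x Y by (auto simp: K_def Cn_def)
      then show ?thesis using v(1) unfolding A_def by blast
    qed
  qed
  show ?thesis
  proof (rule exists_log_relations[of A Y W K])
    show "finite A" using finV F(2) by (simp add: A_def)
    show "Y = (\<Union>a\<in>A. W a)" using covK KW Wsub by blast
    show "Y = (\<Union>a\<in>A. K a)" using covK KW Wsub by blast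
    show "K a \<subseteq> W a" "has_logarithms (W a)" if "a \<in> A" for a using KW logW that by auto
    show "closedin (top_of_set Y) (K a)" if "a \<in> A" for a
    proof -
      have "\<exists>C. compact C \<and> K a = C - {p}"
      proof (cases a)
        case (Inl v)
        then show ?thesis using compCn[of v] by (auto simp: K_def)
      next
        case (Inr x)
        then have "x \<in> F" using that by (auto simp: A_def)
        then show ?thesis using WR(2,4,5)[of x] Inr by (intro exI[of _ "K a"]) auto
      qed
      then obtain C where C: "compact C" "K a = C - {p}" by blast
      have "K a \<subseteq> Y" using KW[OF that] Wsub[OF that] by blast
      then have "K a = Y \<inter> C" using C(2) Y by blast
      then show ?thesis using C(1) by (simp add: closedin_closed_Int compact_imp_closed)
    qed
    show "finite {c \<in> components (W a \<inter> W b). c \<inter> (K a \<inter> K b) \<noteq> {}}" if ab: "a \<in> A" "b \<in> A" for a b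
    proof (cases "compact (K a \<inter> K b)")
      case True
      have "locally connected (W a \<inter> W b)"
        using openW[OF ab(1)] openW[OF ab(2)] lc by (meson locally_open_subset openin_Int)
      then show ?thesis
        using finite_components_meeting_compact[OF _ True] KW[OF ab(1)] KW[OF ab(2)] by blast
    next
      case False
      \<comment> \<open>Noncompactness can arise only at the puncture, hence only between two cones:
        the set \<open>K (Inr x)\<close> of a cell is compact and omits \<open>p\<close>. For two
        cones the overlap of the half planes is convex, so it has at most one component.\<close>
      have "\<exists>v w. a = Inl v \<and> b = Inl w"
      proof (rule ccontr)
        assume neg: "\<not> ?thesis"
        obtain C x where C: "compact C" "x \<in> F" "K a \<inter> K b = (C - {p}) \<inter> K (Inr x)"
        proof (cases a)
          case (Inl v)
          then obtain x where "b = Inr x" "x \<in> F" using neg ab by (auto simp: A_def)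
          then show thesis using that[of "f ` Cn v" x] compCn[of v] Inl by (simp add: K_def)
        next
          case (Inr x)
          then have x: "x \<in> F" using ab by (auto simp: A_def)
          show thesis
          proof (cases b)
            case (Inl v)
            then show thesis using that[of "f ` Cn v" x] compCn[of v] Inr x by (simp add: K_def Int_commute)
          next
            case (Inr y)
            then have y: "y \<in> F" using ab by (auto simp: A_def)
            then have "p \<notin> K b" using WR(2,4)[of y] Inr by blast
            then show thesis using that[of "K b" x] WR(5)[OF y] \<open>a = Inr x\<close> x Inr by (simp add: Int_commute)
          qed
        qed
        have "K a \<inter> K b = C \<inter> K (Inr x)" using C(3) WR(2,4)[OF C(2)] by blast
        then show False using False C(1) WR(5)[OF C(2)] by (simp add: compact_Int)
      qed
      then obtain v w where "a = Inl v" "b = Inl w" by blast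
      then have "W a \<inter> W b = f ` (H v \<inter> H w)" using inj by (simp add: W_def image_Int)
      moreover have "connected (f ` (H v \<inter> H w))"
        using fg convH by (intro connected_continuous_image convex_connected convex_Int)
          (auto simp: homeomorphism_def intro: continuous_on_subset)
      ultimately have "components (W a \<inter> W b) \<subseteq> {W a \<inter> W b}"
        using components_eq_sing_iff[of "W a \<inter> W b"] components_empty by (cases "W a \<inter> W b = {}") auto
      then have "{c \<in> components (W a \<inter> W b). c \<inter> (K a \<inter> K b) \<noteq> {}} \<subseteq> {W a \<inter> W b}" by (rule order_trans[rotated]) simp
      then show ?thesis by (rule finite_subset) simp
    qed
  qed
qed

text \<open>The retraction transfers functions given only off a small disc to the punctured surface, where the
  bound \<open>N\<close> of the previous lemma does not depend on the disc.\<close>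

lemma puncture_retraction:
  assumes S: "closed_surface S" and p: "p \<in> S" and Z: "closed Z" "p \<notin> Z"
  obtains B \<rho> where "openin (top_of_set S) B" "p \<in> B" "B \<inter> Z = {}"
    "continuous_on (S - {p}) \<rho>" "\<rho> ` (S - {p}) \<subseteq> S - B" "\<And>x. x \<in> S - B \<Longrightarrow> \<rho> x = x"
proof -
  obtain f :: "real^2 \<Rightarrow> 'a" and g U where U: "openin (top_of_set S) U"
    and fg: "homeomorphism UNIV U f g" and f0: "f 0 = p"
    using closed_surface_chart[OF S p] by metis
  have US: "U \<subseteq> S" using U openin_imp_subset by blast
  have gf: "g (f y) = y" and fU: "f y \<in> U" and cf: "continuous_on UNIV f" and cg: "continuous_on U g" for y
    using fg by (auto simp: homeomorphism_def)
  have "open (f -` (- Z))" using Z(1) cf open_vimage by blast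
  moreover have "0 \<in> f -` (- Z)" using f0 Z(2) by simp
  ultimately obtain r where r: "r > 0" "ball 0 r \<subseteq> f -` (- Z)" using open_contains_ball by blast
  define B where "B = f ` ball 0 r"
  define T where "T = f ` cball 0 r - {p}"
  \<comment> \<open>Radial projection of the punctured disc onto its boundary circle.\<close>
  define h where "h y = (r / norm y) *\<^sub>R y" for y :: "real^2"
  define \<rho> where "\<rho> x = (if x \<in> S - B then x else f (h (g x)))" for x
  have oB: "openin (top_of_set S) B"
    unfolding B_def by (rule chart_image_openin[OF U fg]) simp
  have pB: "p \<in> B" unfolding B_def using f0 r(1) by force
  have un: "(S - B) \<union> T = S - {p}"
    using pB US fU f0 by (auto simp: T_def B_def)
  have h: "norm (h y) = r" if "y \<noteq> 0" for y using that r(1) by (simp add: h_def)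
  have T: "\<exists>y. x = f y \<and> g x = y \<and> y \<noteq> 0 \<and> norm y \<le> r" if "x \<in> T" for x
    using that f0 gf by (auto simp: T_def)
  have "continuous_on ((S - B) \<union> T) (\<lambda>x. if x \<in> S - B then x else f (h (g x)))"
  proof (rule continuous_on_cases_local)
    have "closedin (top_of_set S) (S - B)" using oB by (simp add: closedin_diff)
    then obtain C where "closed C" "S - B = S \<inter> C" by (meson closedin_closed)
    then have "closed C" "S - B = (S - {p}) \<inter> C" using pB by auto
    then show "closedin (top_of_set ((S - B) \<union> T)) (S - B)"
      unfolding un by (metis closedin_closed_Int)
    have "T = (S - {p}) \<inter> f ` cball 0 r" using US fU by (auto simp: T_def)
    moreover have "closed (f ` cball 0 r)"
      by (intro compact_imp_closed chart_image_compact[OF fg]) simp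
    ultimately show "closedin (top_of_set ((S - B) \<union> T)) T"
      unfolding un by (metis closedin_closed_Int)
    show "continuous_on (S - B) (\<lambda>x. x)" by simp
    have TU: "T \<subseteq> U" using fU by (auto simp: T_def)
    have cgT: "continuous_on T g" using cg TU continuous_on_subset by blast
    have "continuous_on T (\<lambda>x. h (g x))"
      unfolding h_def using T by (intro continuous_intros cgT) auto
    then show "continuous_on T (\<lambda>x. f (h (g x)))"
      using continuous_on_compose2[OF cf] by blast
    \<comment> \<open>The two pieces overlap only in the image of the circle of radius
      \<open>r\<close>, which \<open>h\<close> fixes pointwise.\<close>
    show "x = f (h (g x))" if x: "x \<in> S - B \<and> \<not> x \<in> S - B \<or> x \<in> T \<and> x \<in> S - B" for x
    proof -
      obtain y where y: "x = f y" "g x = y" "y \<noteq> 0" "norm y \<le> r" using T x by blast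
      then have "norm y = r" using x by (auto simp: B_def)
      then show ?thesis using y r(1) by (simp add: h_def)
    qed
  qed
  then have c\<rho>: "continuous_on (S - {p}) \<rho>" unfolding un \<rho>_def .
  have \<rho>B: "\<rho> x \<in> S - B" if x: "x \<in> S - {p}" for x
  proof (cases "x \<in> S - B")
    case True
    then show ?thesis by (simp add: \<rho>_def)
  next
    case False
    then have "x \<in> T" using un x by blast
    then obtain y where y: "x = f y" "g x = y" "y \<noteq> 0" "norm y \<le> r" using T by blast
    have "f (h y) \<notin> B"
    proof
      assume "f (h y) \<in> B"
      then obtain u where "f (h y) = f u" "norm u < r" by (auto simp: B_def)
      then have "h y = u" using gf by metis
      then show False using h[OF y(3)] \<open>norm u < r\<close> by simp
    qed
    moreover have "f (h y) \<in> S" using fU US by blast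
    moreover have "\<rho> x = f (h y)" using False y(2) by (simp only: \<rho>_def if_False)
    ultimately show ?thesis by simp
  qed
  show thesis
  proof (rule that[OF oB pB _ c\<rho>])
    show "B \<inter> Z = {}" using r(2) by (auto simp: B_def)
    show "\<rho> ` (S - {p}) \<subseteq> S - B" using \<rho>B by (rule image_subsetI)
    show "\<rho> x = x" if "x \<in> S - B" for x using that by (simp add: \<rho>_def)
  qed
qed

section \<open>Separation and complementary domains\<close>

lemma closed_urysohn:
  fixes P P' :: "'a::metric_space set"
  assumes "closed P" "closed P'" "P \<noteq> {}" "P' \<noteq> {}" "P \<inter> P' = {}"
  obtains h :: "'a \<Rightarrow> real" where "continuous_on UNIV h" "\<And>x. x \<in> P \<Longrightarrow> h x = 1" "\<And>x. x \<in> P' \<Longrightarrow> h x = 0"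
proof
  define h where "h x = infdist x P' / (infdist x P + infdist x P')" for x
  have pos: "infdist x P + infdist x P' \<noteq> 0" for x
  proof
    assume "infdist x P + infdist x P' = 0"
    then have "infdist x P = 0" "infdist x P' = 0"
      using infdist_nonneg[of x P] infdist_nonneg[of x P'] by linarith+
    then show False using assms in_closed_iff_infdist_zero by (metis disjoint_iff)
  qed
  show "continuous_on UNIV h"
    unfolding h_def using pos by (intro continuous_intros) auto
  show "h x = 1" if "x \<in> P" for x
  proof -
    have "infdist x P = 0" using that by simp
    then show ?thesis using pos[of x] by (simp add: h_def)
  qed
  show "h x = 0" if "x \<in> P'" for x
    using that by (simp add: h_def)
qed

lemma prod_power_int_distrib:
  fixes f :: "'i \<Rightarrow> 'b::field"
  shows "(\<Prod>i\<in>I. f i) powi n = (\<Prod>i\<in>I. f i powi n)"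
  by (induction I rule: infinite_finite_induct) (simp_all add: power_int_mult_distrib)

lemma components_diff_openin:
  assumes S: "locally connected S" and X: "closed X" and \<U>: "\<U> \<subseteq> components (S - X)"
  shows "openin (top_of_set S) (\<Union>\<U>)"
proof (rule openin_Union)
  fix U assume "U \<in> \<U>"
  have *: "openin (top_of_set S) (S - X)"
    using X by (simp add: Diff_eq openin_open_Int open_Compl)
  then have "openin (top_of_set (S - X)) U"
    using openin_components_locally_connected locally_open_subset[OF S] \<U> \<open>U \<in> \<U>\<close> by blast
  then show "openin (top_of_set S) U" using * openin_trans by blast
qed

text \<open>A connected subset of \<open>K\<close> meeting \<open>A\<close> and \<open>A'\<close>
  would have a proper subcontinuum of \<open>X\<close> as closure, against \<open>sep\<close>. By
  the cut wire fence theorem \<open>K\<close> then splits into clopen parts around \<open>A\<close>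
  and \<open>A'\<close>, and a Urysohn function for these parts is defined on the whole
  space.\<close>

lemma separating_function:
  fixes X :: "'a::metric_space set"
  assumes K: "compact K" "K \<subset> X"
    and A: "compact A" "A \<noteq> {}" "A \<subseteq> K" and A': "compact A'" "A' \<noteq> {}" "A' \<subseteq> K"
    and sep: "\<And>C. continuum C \<Longrightarrow> C \<subset> X \<Longrightarrow> C \<inter> A = {} \<or> C \<inter> A' = {}"
  obtains h :: "'a \<Rightarrow> real" where "continuous_on UNIV h" "\<And>x. x \<in> K \<Longrightarrow> h x \<in> {0, 1}"
    "\<And>x. x \<in> A \<Longrightarrow> h x = 1" "\<And>x. x \<in> A' \<Longrightarrow> h x = 0"
proof -
  have "separated_between (top_of_set K) A A'"
  proof (rule cut_wire_fence_theorem)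
    show "compact_space (top_of_set K)" using K by (simp add: compact_space_subtopology)
    show "Hausdorff_space (top_of_set K)" by (simp add: Hausdorff_space_subtopology)
    show "closedin (top_of_set K) A" "closedin (top_of_set K) A'"
      using A A' by (auto simp: closed_subset compact_imp_closed)
    fix C assume C: "connectedin (top_of_set K) C"
    then have CK: "C \<subseteq> K" "connected C" by (auto simp: connectedin_subtopology)
    show "disjnt C A \<or> disjnt C A'"
    proof (cases "C = {}")
      case False
      have sub: "closure C \<subseteq> K" using CK(1) K(1) by (simp add: closure_minimal compact_imp_closed)
      have "compact (closure C)"
        using closedin_compact[OF K(1) closed_subset[OF sub closed_closure]] .
      then have "continuum (closure C)"
        using CK(2) False by (simp add: continuum_def connected_imp_connected_closure)
      moreover have "closure C \<subset> X" using sub K(2) by blast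
      ultimately have "closure C \<inter> A = {} \<or> closure C \<inter> A' = {}" by (rule sep)
      then show ?thesis using closure_subset[of C] by (auto simp: disjnt_def)
    qed auto
  qed
  then obtain P where P: "closedin (top_of_set K) P" "openin (top_of_set K) P" "A \<subseteq> P" "A' \<subseteq> K - P"
    unfolding separated_between by auto
  have PK: "P \<subseteq> K" using P(1) closedin_imp_subset by blast
  have "closedin (top_of_set K) (K - P)" using P(2) by (simp add: closedin_diff)
  then have "closed P" "closed (K - P)"
    using K(1) P(1) closedin_compact compact_imp_closed by blast+
  moreover have "P \<noteq> {}" "K - P \<noteq> {}" "P \<inter> (K - P) = {}" using P A(2) A'(2) by blast+
  ultimately obtain h :: "'a \<Rightarrow> real" where h: "continuous_on UNIV h" "\<And>x. x \<in> P \<Longrightarrow> h x = 1"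
    "\<And>x. x \<in> K - P \<Longrightarrow> h x = 0"
    by (rule closed_urysohn) (rule that)
  show thesis
  proof (rule that[OF h(1)])
    show "h x \<in> {0, 1}" if "x \<in> K" for x using h(2,3)[of x] that by (cases "x \<in> P") auto
    show "h x = 1" if "x \<in> A" for x using h(2) P(3) that by blast
    show "h x = 0" if "x \<in> A'" for x using h(3) P(4) that by blast
  qed
qed

text \<open>The puncture \<open>p\<close> makes \<open>K = X - B0\<close> a proper subset of
  \<open>X\<close>, so that different composants can be separated inside it; the sets
  \<open>B i\<close> stay away from \<open>p\<close> so that the disc \<open>B0\<close> can avoid
  them.\<close>

lemma domain_meeting_all:
  fixes S X :: "'a::metric_space set" and B :: "'i \<Rightarrow> 'a set"
  assumes S: "closed_surface S" and XS: "X \<subseteq> S" and X: "indecomposable X" "X \<noteq> {p}" and p: "p \<in> X"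
    and I: "finite I" "I \<noteq> {}"
    and B: "\<And>i. i \<in> I \<Longrightarrow> openin (top_of_set S) (B i)" "\<And>i. i \<in> I \<Longrightarrow> connected (B i)"
      "\<And>i. i \<in> I \<Longrightarrow> B i \<inter> X \<noteq> {}" "\<And>i. i \<in> I \<Longrightarrow> p \<notin> closure (B i)"
  shows "\<exists>U \<in> components (S - X). \<forall>i\<in>I. U \<inter> B i \<noteq> {}"
proof (rule ccontr)
  assume "\<not> ?thesis"
  then have "\<forall>U\<in>components (S - X). \<exists>i\<in>I. U \<inter> B i = {}" by blast
  \<comment> \<open>\<open>\<kappa>\<close> assigns to each domain the index of one set that it
    misses, which sorts the domains into the classes \<open>D i\<close>.\<close>
  then obtain \<kappa> where \<kappa>: "\<And>U. U \<in> components (S - X) \<Longrightarrow> \<kappa> U \<in> I"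
    "\<And>U. U \<in> components (S - X) \<Longrightarrow> U \<inter> B (\<kappa> U) = {}"
    by metis
  have cX: "compact X" using X by (simp add: indecomposable_def continuum_def)
  have lc: "locally connected S" by (rule closed_surface_locally_connected[OF S])
  define k where "k x = \<kappa> (connected_component_set (S - X) x)" for x
  define D where "D i = \<Union>{U \<in> components (S - X). \<kappa> U = i}" for i
  have memD: "x \<in> D i \<longleftrightarrow> x \<in> S - X \<and> k x = i" for x i
  proof
    assume "x \<in> D i"
    then obtain U where U: "U \<in> components (S - X)" "\<kappa> U = i" "x \<in> U" by (auto simp: D_def)
    then have "U = connected_component_set (S - X) x"
      by (metis components_iff connected_component_eq)
    then show "x \<in> S - X \<and> k x = i" using U in_components_subset by (auto simp: k_def)
  next
    assume x: "x \<in> S - X \<and> k x = i"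
    then have "connected_component_set (S - X) x \<in> components (S - X)" by (auto simp: components_def)
    moreover have "x \<in> connected_component_set (S - X) x" using x by simp
    ultimately show "x \<in> D i" using x unfolding D_def k_def by blast
  qed
  have kI: "k x \<in> I" if "x \<in> S - X" for x
  proof -
    have "connected_component_set (S - X) x \<in> components (S - X)" using that by (auto simp: components_def)
    then show ?thesis unfolding k_def by (rule \<kappa>(1))
  qed
  have DB: "D i \<inter> B i = {}" for i using \<kappa>(2) by (auto simp: D_def)
  have D1: "openin (top_of_set S) (D i)" for i
    unfolding D_def by (rule components_diff_openin[OF lc compact_imp_closed[OF cX]]) blast
  \<comment> \<open>With \<open>D1\<close> this makes \<open>D i\<close> clopen in
    \<open>S - X\<close>, so a function may be changed on \<open>D i\<close> alone if the two
    versions agree on \<open>X\<close>.\<close>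
  have D2: "openin (top_of_set S) (S - X - D i)" for i
  proof -
    have "S - X - D i = \<Union>{U \<in> components (S - X). \<kappa> U \<noteq> i}"
    proof (intro equalityI subsetI)
      fix x assume x: "x \<in> S - X - D i"
      then have "x \<in> connected_component_set (S - X) x" "connected_component_set (S - X) x \<in> components (S - X)"
        by (auto simp: components_def)
      moreover have "\<kappa> (connected_component_set (S - X) x) \<noteq> i" using x memD by (auto simp: k_def)
      ultimately show "x \<in> \<Union>{U \<in> components (S - X). \<kappa> U \<noteq> i}" by blast
    next
      fix x assume "x \<in> \<Union>{U \<in> components (S - X). \<kappa> U \<noteq> i}"
      then obtain U where U: "U \<in> components (S - X)" "\<kappa> U \<noteq> i" "x \<in> U" by blast
      then have "U = connected_component_set (S - X) x"
        by (metis components_iff connected_component_eq)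
      then show "x \<in> S - X - D i" using U memD in_components_subset by (auto simp: k_def)
    qed
    then show ?thesis using components_diff_openin[OF lc compact_imp_closed[OF cX]]
      by (metis (no_types, lifting) mem_Collect_eq subsetI)
  qed

  define Y where "Y = S - {p}"
  have "\<exists>N. \<forall>(I::'i set) (J::'a set) (\<theta> :: 'i \<Rightarrow> 'a \<Rightarrow> 'a \<Rightarrow> complex).
    finite I \<longrightarrow> finite J \<longrightarrow> card I * N < card J \<longrightarrow>
    (\<forall>i\<in>I. \<forall>j\<in>J. continuous_on Y (\<theta> i j) \<and> (\<forall>x\<in>Y. \<theta> i j x \<noteq> 0)) \<longrightarrow>
    (\<exists>\<alpha>::'a \<Rightarrow> int. (\<exists>j\<in>J. \<alpha> j \<noteq> 0) \<and>
      (\<forall>i\<in>I. \<exists>G. continuous_on Y G \<and> (\<forall>x\<in>Y. exp (G x) = (\<Prod>j\<in>J. \<theta> i j x powi \<alpha> j))))"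
    using p XS by (intro punctured_surface_log_relations[OF S _ Y_def]) blast
  then obtain N where N: "\<forall>(I::'i set) (J::'a set) (\<theta> :: 'i \<Rightarrow> 'a \<Rightarrow> 'a \<Rightarrow> complex).
    finite I \<longrightarrow> finite J \<longrightarrow> card I * N < card J \<longrightarrow>
    (\<forall>i\<in>I. \<forall>j\<in>J. continuous_on Y (\<theta> i j) \<and> (\<forall>x\<in>Y. \<theta> i j x \<noteq> 0)) \<longrightarrow>
    (\<exists>\<alpha>::'a \<Rightarrow> int. (\<exists>j\<in>J. \<alpha> j \<noteq> 0) \<and>
      (\<forall>i\<in>I. \<exists>G. continuous_on Y G \<and> (\<forall>x\<in>Y. exp (G x) = (\<Prod>j\<in>J. \<theta> i j x powi \<alpha> j))))"
    by (elim exE)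

  have "\<forall>i\<in>I. \<exists>O'. open O' \<and> B i = S \<inter> O'" using B(1) by (meson openin_open)
  then obtain O' where O': "\<And>i. i \<in> I \<Longrightarrow> open (O' i)" "\<And>i. i \<in> I \<Longrightarrow> B i = S \<inter> O' i" by metis
  have OX: "\<forall>i\<in>I. open (O' i) \<and> O' i \<inter> X \<noteq> {}" using O' B(3) by blast
  obtain Q :: "'a set" and L where Q: "finite Q" "card Q = card I * N + 2"
    and L: "\<And>q. q \<in> Q \<Longrightarrow> continuum (L q)" "\<And>q. q \<in> Q \<Longrightarrow> L q \<subset> X" "\<And>q. q \<in> Q \<Longrightarrow> p \<notin> L q"
    and LO: "\<And>q i. q \<in> Q \<Longrightarrow> i \<in> I \<Longrightarrow> L q \<inter> O' i \<noteq> {}"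
    and Lsep: "\<And>q q' C. q \<in> Q \<Longrightarrow> q' \<in> Q \<Longrightarrow> q \<noteq> q' \<Longrightarrow> continuum C \<Longrightarrow> C \<subset> X \<Longrightarrow> C \<inter> L q = {} \<or> C \<inter> L q' = {}"
    by (rule composant_continua[OF X p I(1) OX, where n="card I * N + 2"]) (rule that)
  have LB: "L q \<inter> B i \<noteq> {}" if "q \<in> Q" "i \<in> I" for q i
    using LO[OF that] O'(2)[OF that(2)] L(2)[OF that(1)] XS by blast
  have Lne: "L q \<noteq> {}" and Lcomp: "compact (L q)" and Lconn: "connected (L q)" if "q \<in> Q" for q
    using L(1)[OF that] by (auto simp: continuum_def)
  have "Q \<noteq> {}" using Q(2) by auto
  then obtain q0 where q0: "q0 \<in> Q" by blast
  \<comment> \<open>\<open>q0\<close> is the reference continuum. The summand 2 in the size of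
    \<open>Q\<close> leaves \<open>card I * N + 1\<close> elements, as the strict bound
    requires.\<close>
  define J where "J = Q - {q0}"
  have J: "finite J" "card I * N < card J" using Q q0 by (auto simp: J_def)

  \<comment> \<open>Everything that the disc about \<open>p\<close> must avoid.\<close>
  define Z where "Z = (\<Union>q\<in>Q. L q) \<union> (\<Union>i\<in>I. closure (B i))"
  have "closed Z" unfolding Z_def using Q(1) I(1) Lcomp
    by (intro closed_Un closed_UN) (auto simp: compact_imp_closed)
  moreover have "p \<notin> Z" using L(3) B(4) by (auto simp: Z_def)
  moreover have "p \<in> S" using p XS by blast
  ultimately obtain B0 \<rho> where oB0: "openin (top_of_set S) B0" and B0: "p \<in> B0" "B0 \<inter> Z = {}"
    and \<rho>: "continuous_on Y \<rho>" "\<rho> ` Y \<subseteq> S - B0" "\<And>x. x \<in> S - B0 \<Longrightarrow> \<rho> x = x"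
    using puncture_retraction[OF S, of p Z] unfolding Y_def by metis
  have LZ: "L q \<subseteq> S - B0" if "q \<in> Q" for q
    using that B0(2) L(2)[OF that] XS by (auto simp: Z_def)
  have BZ: "B i \<subseteq> S - B0" if "i \<in> I" for i
  proof -
    have "B i \<subseteq> Z" using closure_subset that by (auto simp: Z_def)
    then show ?thesis using B0(2) openin_imp_subset[OF B(1)[OF that]] by blast
  qed
  have EY: "S - B0 \<subseteq> Y" using B0(1) by (auto simp: Y_def)

  have closedE: "closedin (top_of_set S) (S - B0)" using oB0 by (simp add: closedin_diff)
  have compS: "compact S" using S by (simp add: closed_surface_def)
  have compE: "compact (S - B0)" using closedin_compact[OF compS closedE] .
  define K where "K = X - B0"
  have "K = X \<inter> (S - B0)" using XS by (auto simp: K_def)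
  then have compK: "compact K" using cX compE by (simp add: compact_Int)
  have KX: "K \<subset> X" using p B0(1) by (auto simp: K_def)
  have LK: "L q \<subseteq> K" if "q \<in> Q" for q using LZ[OF that] L(2)[OF that] by (auto simp: K_def)
  have exh: "\<exists>h::'a \<Rightarrow> real. continuous_on UNIV h \<and> (\<forall>x\<in>K. h x \<in> {0,1}) \<and> (\<forall>x\<in>L q. h x = 1) \<and>
      (\<forall>q'\<in>Q - {q}. \<forall>x\<in>L q'. h x = 0)" if q: "q \<in> J" for q
  proof -
    have qQ: "q \<in> Q" "q0 \<in> Q - {q}" using q q0 by (auto simp: J_def)
    let ?A = "\<Union>q'\<in>Q - {q}. L q'"
    have A: "compact ?A" using Q(1) Lcomp by (intro compact_UN) auto
    have Ane: "?A \<noteq> {}" using qQ(2) Lne[OF q0] by blast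
    have AK: "?A \<subseteq> K" using LK by blast
    have sep: "C \<inter> L q = {} \<or> C \<inter> ?A = {}" if C: "continuum C" "C \<subset> X" for C
    proof (rule disjCI)
      assume "C \<inter> ?A \<noteq> {}"
      then obtain q' where "q' \<in> Q" "q' \<noteq> q" "C \<inter> L q' \<noteq> {}" by blast
      then show "C \<inter> L q = {}" using Lsep[OF qQ(1) _ _ C, of q'] by blast
    qed
    obtain h :: "'a \<Rightarrow> real" where h: "continuous_on UNIV h" "\<And>x. x \<in> K \<Longrightarrow> h x \<in> {0, 1}"
      "\<And>x. x \<in> L q \<Longrightarrow> h x = 1" "\<And>x. x \<in> ?A \<Longrightarrow> h x = 0"
      using separating_function[OF compK KX Lcomp[OF qQ(1)] Lne[OF qQ(1)] LK[OF qQ(1)] A Ane AK sep]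
      by blast
    show ?thesis
      by (rule exI[of _ h]) (use h in blast)
  qed
  have "\<forall>q\<in>J. \<exists>h::'a \<Rightarrow> real. continuous_on UNIV h \<and> (\<forall>x\<in>K. h x \<in> {0,1}) \<and> (\<forall>x\<in>L q. h x = 1) \<and>
      (\<forall>q'\<in>Q - {q}. \<forall>x\<in>L q'. h x = 0)"
    using exh by (rule ballI)
  from bchoice[OF this] obtain h :: "'a \<Rightarrow> 'a \<Rightarrow> real" where hh: "\<forall>q\<in>J. continuous_on UNIV (h q) \<and>
      (\<forall>x\<in>K. h q x \<in> {0,1}) \<and> (\<forall>x\<in>L q. h q x = 1) \<and> (\<forall>q'\<in>Q - {q}. \<forall>x\<in>L q'. h q x = 0)"
    by (elim exE)
  have h: "continuous_on UNIV (h q)" if "q \<in> J" for q using hh that by blast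
  have hK: "h q x = 0 \<or> h q x = 1" if "q \<in> J" "x \<in> K" for q x using hh that by blast
  have h1: "h q x = 1" if "q \<in> J" "x \<in> L q" for q x using hh that by blast
  have h0: "h q x = 0" if "q \<in> J" "q' \<in> Q" "q' \<noteq> q" "x \<in> L q'" for q q' x using hh that by blast

  define e where "e q x = exp (of_real (h q x) * (2 * of_real pi * \<i>))" for q x
  have e1: "e q x = 1" if "q \<in> J" "x \<in> K" for q x
  proof -
    have "exp (2 * of_real pi * \<i>) = 1" using exp_eq_1 by auto
    then show ?thesis using hK[OF that] by (auto simp: e_def)
  qed
  have conte: "continuous_on T (e q)" if "q \<in> J" for q T
    unfolding e_def by (intro continuous_intros continuous_on_subset[OF h[OF that]]) auto
  \<comment> \<open>Composition with \<open>\<rho>\<close> extends the function from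
    \<open>S - B0\<close> to all of \<open>Y\<close>, where the relations are available.\<close>
  define \<theta> where "\<theta> i q x = (if \<rho> x \<in> D i then e q (\<rho> x) else 1)" for i q x
  have cont\<theta>: "continuous_on Y (\<theta> i q)" if q: "q \<in> J" for i q
  proof -
    \<comment> \<open>\<open>T1\<close> and \<open>T2\<close> are the parts of \<open>S - B0\<close>
      in \<open>X \<union> D i\<close> and off \<open>D i\<close>. Both are closed and they meet in
      \<open>K\<close>, where \<open>h q\<close> is an integer and hence \<open>e q\<close> equals
      1.\<close>
    define T1 where "T1 = (S - B0) \<inter> (S - (S - X - D i))"
    define T2 where "T2 = (S - B0) \<inter> (S - D i)"
    have un: "T1 \<union> T2 = S - B0" using memD by (auto simp: T1_def T2_def)
    have "continuous_on (T1 \<union> T2) (\<lambda>x. if x \<in> D i then e q x else 1)"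
    proof (rule continuous_on_cases_local)
      have "closedin (top_of_set S) (S - (S - X - D i))" "closedin (top_of_set S) (S - D i)"
        using D1 D2 by (simp_all add: closedin_diff)
      then have "closedin (top_of_set S) T1" "closedin (top_of_set S) T2"
        unfolding T1_def T2_def using closedE by (simp_all add: closedin_Int)
      then show "closedin (top_of_set (T1 \<union> T2)) T1" "closedin (top_of_set (T1 \<union> T2)) T2"
        unfolding un by (auto intro: closedin_subset_trans simp: T1_def T2_def)
      show "continuous_on T1 (e q)" by (rule conte[OF q])
      show "continuous_on T2 (\<lambda>x. 1 :: complex)" by simp
      show "e q x = 1" if x: "x \<in> T1 \<and> x \<notin> D i \<or> x \<in> T2 \<and> x \<in> D i" for x
      proof -
        have "x \<in> K" using x by (auto simp: T1_def T2_def K_def)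
        then show ?thesis using e1[OF q] by blast
      qed
    qed
    then have "continuous_on (S - B0) (\<lambda>x. if x \<in> D i then e q x else 1)" unfolding un .
    then show ?thesis unfolding \<theta>_def using continuous_on_compose2[OF _ \<rho>(1,2)] by blast
  qed
  have \<theta>0: "\<theta> i q x \<noteq> 0" for i q x by (simp add: \<theta>_def e_def)
  have "\<forall>i\<in>I. \<forall>q\<in>J. continuous_on Y (\<theta> i q) \<and> (\<forall>x\<in>Y. \<theta> i q x \<noteq> 0)"
    using cont\<theta> \<theta>0 by blast
  from N[THEN spec, THEN spec, THEN spec, THEN mp, OF I(1), THEN mp, THEN mp, OF J, THEN mp, OF this]
  obtain \<alpha> :: "'a \<Rightarrow> int" where \<alpha>: "\<exists>j\<in>J. \<alpha> j \<noteq> 0"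
    and "\<forall>i\<in>I. \<exists>G. continuous_on Y G \<and> (\<forall>x\<in>Y. exp (G x) = (\<Prod>j\<in>J. \<theta> i j x powi \<alpha> j))"
    by (elim exE conjE)
  then obtain G where G: "\<And>i. i \<in> I \<Longrightarrow> continuous_on Y (G i)"
    "\<And>i x. i \<in> I \<Longrightarrow> x \<in> Y \<Longrightarrow> exp (G i x) = (\<Prod>j\<in>J. \<theta> i j x powi \<alpha> j)"
    by metis
  have prod\<theta>: "(\<Prod>i\<in>I. \<theta> i q x) = e q x" if q: "q \<in> J" and x: "x \<in> S - B0" for q x
  proof (cases "x \<in> X")
    case True
    then have "x \<in> K" "\<And>i. \<theta> i q x = 1" using x memD \<rho>(3)[OF x] by (auto simp: K_def \<theta>_def)
    then show ?thesis using e1[OF q] by simp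
  next
    case False
    then have xS: "x \<in> S - X" using x by blast
    \<comment> \<open>A point off \<open>X\<close> lies in exactly one class \<open>D i\<close>, so
      exactly one factor of the product can differ from 1.\<close>
    have "\<theta> i q x = (if k x = i then e q x else 1)" for i
      using memD[of x i] xS by (simp add: \<theta>_def \<rho>(3)[OF x])
    then have "(\<Prod>i\<in>I. \<theta> i q x) = (\<Prod>i\<in>I. if k x = i then e q x else 1)" by simp
    also have "\<dots> = e q x" using kI[OF xS] I(1) by (simp add: prod.delta)
    finally show ?thesis .
  qed
  \<comment> \<open>The difference of two logarithms of the same product, hence constant on
    connected subsets of \<open>S - B0\<close>.\<close>
  define F where "F x = (\<Sum>i\<in>I. G i x) - (\<Sum>j\<in>J. of_int (\<alpha> j) * (of_real (h j x) * (2 * of_real pi * \<i>)))" for x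
  have contF: "continuous_on (S - B0) F"
    unfolding F_def by (intro continuous_intros continuous_on_subset[OF G(1) EY] continuous_on_subset[OF h]) auto
  have expF: "exp (F x) = 1" if x: "x \<in> S - B0" for x
  proof -
    have xY: "x \<in> Y" using x EY by blast
    have "exp (\<Sum>i\<in>I. G i x) = (\<Prod>i\<in>I. \<Prod>j\<in>J. \<theta> i j x powi \<alpha> j)"
      using I(1) G(2)[OF _ xY] by (simp add: exp_sum)
    also have "\<dots> = (\<Prod>j\<in>J. (\<Prod>i\<in>I. \<theta> i j x) powi \<alpha> j)"
      by (subst prod.swap) (simp add: prod_power_int_distrib)
    also have "\<dots> = (\<Prod>j\<in>J. e j x powi \<alpha> j)"
      using prod\<theta>[OF _ x] by (intro prod.cong) auto
    also have "\<dots> = exp (\<Sum>j\<in>J. of_int (\<alpha> j) * (of_real (h j x) * (2 * of_real pi * \<i>)))"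
      using J(1) by (simp add: exp_sum exp_power_int e_def)
    finally show ?thesis by (simp add: F_def exp_diff)
  qed
  have "\<alpha> q = 0" if q: "q \<in> J" for q
  proof -
    have qQ: "q \<in> Q" using q by (simp add: J_def)
    obtain x y where x: "x \<in> L q0" and y: "y \<in> L q" using Lne[OF q0] Lne[OF qQ] by blast
    \<comment> \<open>A connected bridge from \<open>L q0\<close> to \<open>L q\<close> through
      \<open>B i\<close>. It misses \<open>D i\<close>, so all \<open>\<theta> i j\<close> equal 1
      on it and \<open>G i\<close> is constant there.\<close>
    define M where "M i = L q0 \<union> B i \<union> L q" for i
    have M: "connected (M i)" "M i \<subseteq> S - B0" "x \<in> M i" "y \<in> M i" if i: "i \<in> I" for i
    proof -
      have "connected (L q0 \<union> B i)"
        using Lconn[OF q0] B(2)[OF i] LB[OF q0 i] by (rule connected_Un)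
      then show "connected (M i)"
        unfolding M_def by (rule connected_Un[OF _ Lconn[OF qQ]]) (use LB[OF qQ i] in blast)
      show "M i \<subseteq> S - B0" unfolding M_def using LZ[OF q0] LZ[OF qQ] BZ[OF i] by blast
    qed (use x y in \<open>auto simp: M_def\<close>)
    have Gxy: "G i x = G i y" if i: "i \<in> I" for i
    proof -
      have "exp (G i z) = 1" if z: "z \<in> M i" for z
      proof -
        have zE: "z \<in> S - B0" using z M(2)[OF i] by blast
        have "z \<notin> D i" using z DB[of i] L(2)[OF q0] L(2)[OF qQ] memD[of z i] by (auto simp: M_def)
        then have "\<theta> i j z = 1" for j using \<rho>(3)[OF zE] by (simp add: \<theta>_def)
        then show ?thesis using G(2)[OF i, of z] zE EY by auto
      qed
      moreover have "continuous_on (M i) (G i)"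
        using continuous_on_subset[OF G(1)[OF i]] M(2)[OF i] EY by blast
      ultimately have "G i constant_on M i" using connected_exp_eq_1_constant M(1)[OF i] by blast
      then show ?thesis using M(3,4)[OF i] by (auto simp: constant_on_def)
    qed
    \<comment> \<open>Each \<open>G i\<close> needed its own bridge, but a single bridge suffices
      for \<open>F\<close>. Comparing \<open>F\<close> at \<open>x\<close> and \<open>y\<close>, the
      sums of the \<open>G i\<close> cancel and only the term with \<open>\<alpha> q\<close> is
      left.\<close>
    obtain i where i: "i \<in> I" using I(2) by blast
    have "F constant_on M i"
      using connected_exp_eq_1_constant[OF M(1)[OF i] continuous_on_subset[OF contF M(2)[OF i]]]
        expF M(2)[OF i] by blast
    then have "F x = F y" using M(3,4)[OF i] by (auto simp: constant_on_def)
    moreover have "(\<Sum>i\<in>I. G i x) = (\<Sum>i\<in>I. G i y)" using Gxy by (intro sum.cong) auto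
    moreover have "h j x = 0" if "j \<in> J" for j using h0[OF that q0 _ x] that by (auto simp: J_def)
    moreover have "h j y = (if q = j then 1 else 0)" if "j \<in> J" for j
      using h0[OF that qQ _ y] h1[OF that, of y] y by auto
    ultimately have "(\<Sum>j\<in>J. of_int (\<alpha> j) * (of_real (if q = j then 1 else 0) * (2 * of_real pi * \<i>))) = (0::complex)"
      unfolding F_def by simp
    moreover have "(\<Sum>j\<in>J. of_int (\<alpha> j) * (of_real (if q = j then 1 else 0) * (2 * of_real pi * \<i>)))
        = (\<Sum>j\<in>J. if q = j then of_int (\<alpha> j) * (2 * of_real pi * \<i>) else (0::complex))"
      by (intro sum.cong) auto
    moreover have "\<dots> = of_int (\<alpha> q) * (2 * of_real pi * \<i>)"
      using J(1) q by (simp add: sum.delta)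
    ultimately show ?thesis by simp
  qed
  then show False using \<alpha> by blast
qed

section \<open>Frontiers of domains and Hausdorff convergence\<close>

lemma frontier_of_component_subset:
  assumes S: "locally connected S" and X: "closed X" and U: "U \<in> components (S - X)"
  shows "(top_of_set S) frontier_of U \<subseteq> X"
proof (rule ccontr)
  assume "\<not> ?thesis"
  then obtain y where y: "y \<in> (top_of_set S) frontier_of U" "y \<notin> X" by blast
  have oU: "openin (top_of_set S) U"
    using components_diff_openin[OF S X, of "{U}"] U by simp
  have yc: "y \<in> (top_of_set S) closure_of U" "y \<notin> U"
    using y(1) oU by (auto simp: frontier_of_def interior_of_openin)
  then have "y \<in> S" by (simp add: in_closure_of)
  then have "y \<in> \<Union>(components (S - X))" using y(2) by simp
  then obtain V where V: "V \<in> components (S - X)" "y \<in> V" by blast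
  have "openin (top_of_set S) V"
    using components_diff_openin[OF S X, of "{V}"] V by simp
  \<comment> \<open>The open domain \<open>V\<close> is a neighbourhood of a point in the closure of
    \<open>U\<close>.\<close>
  then have "U \<inter> V \<noteq> {}" using yc(1) V(2) unfolding in_closure_of by blast
  then have "U = V" using components_nonoverlap[OF U V(1)] by blast
  then show False using V(2) yc(2) by simp
qed

text \<open>A connected set of radius \<open>\<epsilon>/2\<close> about a net point that meets both
  \<open>U\<close> and \<open>X\<close> must meet the frontier of \<open>U\<close>. A one-point
  \<open>X\<close> is treated apart: there connectedness of \<open>S\<close> makes the frontier of
  any domain equal to \<open>X\<close>.\<close>

lemma domain_frontier_dense:
  assumes S: "closed_surface S" and XS: "X \<subseteq> S" and X: "indecomposable X" and \<epsilon>: "\<epsilon> > 0"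
  shows "\<exists>U \<in> components (S - X). \<forall>x\<in>X. infdist x ((top_of_set S) frontier_of U) \<le> \<epsilon>"
proof (cases "\<exists>p. X = {p}")
  case True
  then obtain p where p: "X = {p}" by blast
  then have pS: "p \<in> S" using XS by blast
  obtain f :: "real^2 \<Rightarrow> 'a" and g U where U: "openin (top_of_set S) U"
    and fg: "homeomorphism UNIV U f g" and f0: "f 0 = p"
    using closed_surface_chart[OF S pS] by metis
  have "U \<subseteq> S" using U openin_imp_subset by blast
  then have fS: "f v \<in> S" for v using fg by (auto simp: homeomorphism_def)
  have "g (f v) = v" for v using fg by (simp add: homeomorphism_def)
  then have "f 1 \<noteq> p" using f0 by (metis zero_neq_one)
  then have "f 1 \<in> \<Union>(components (S - X))" using fS p by simp
  then obtain W where W: "W \<in> components (S - X)" "f 1 \<in> W" by blast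
  have "connected S" using S by (simp add: closed_surface_def)
  then have "connectedin (top_of_set S) S" by (simp add: connectedin_subtopology)
  moreover have "S \<inter> W \<noteq> {}" using W(2) fS by blast
  moreover have "S - W \<noteq> {}" using pS in_components_subset[OF W(1)] p by blast
  ultimately have "S \<inter> (top_of_set S) frontier_of W \<noteq> {}" by (rule connectedin_Int_frontier_of)
  moreover have "(top_of_set S) frontier_of W \<subseteq> X"
    using frontier_of_component_subset[OF closed_surface_locally_connected[OF S] _ W(1)] p by simp
  ultimately have "(top_of_set S) frontier_of W = X" using p by blast
  then show ?thesis using W(1) \<epsilon> by (intro bexI[OF _ W(1)]) simp
next
  case False
  have cX: "compact X" "connected X" "X \<noteq> {}" using X by (auto simp: indecomposable_def continuum_def)
  have lc: "locally connected S" by (rule closed_surface_locally_connected[OF S])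
  have "infinite X" using connected_finite_iff_sing[OF cX(2)] cX(3) False by blast
  obtain k where k: "k \<subseteq> X" "finite k" "X \<subseteq> (\<Union>x\<in>k. ball x (\<epsilon>/2))"
  proof (rule compactE_image[OF cX(1), of X "\<lambda>x. ball x (\<epsilon>/2)"])
    show "X \<subseteq> (\<Union>x\<in>X. ball x (\<epsilon>/2))" using \<epsilon> by force
  qed (auto intro: that)
  have kne: "k \<noteq> {}" using k(3) cX(3) by auto
  \<comment> \<open>A puncture outside the finite net exists since \<open>X\<close> is infinite;
    halving the distances to it keeps the closures of the \<open>B x\<close> away from it.\<close>
  have "\<not> X \<subseteq> k" using \<open>infinite X\<close> k(2) finite_subset by blast
  then obtain p where p: "p \<in> X" "p \<notin> k" by blast
  have "\<exists>B. openin (top_of_set S) B \<and> connected B \<and> x \<in> B \<and> B \<subseteq> S \<inter> ball x (min (\<epsilon>/2) (dist x p / 2))"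
    if x: "x \<in> k" for x
  proof -
    have "x \<noteq> p" using x p(2) by blast
    then have "x \<in> S \<inter> ball x (min (\<epsilon>/2) (dist x p / 2))" using \<epsilon> x k(1) XS by auto
    moreover have "openin (top_of_set S) (S \<inter> ball x (min (\<epsilon>/2) (dist x p / 2)))"
      by (simp add: openin_open_Int)
    ultimately show ?thesis using lc unfolding locally_connected by blast
  qed
  then obtain B where B: "\<And>x. x \<in> k \<Longrightarrow> openin (top_of_set S) (B x)" "\<And>x. x \<in> k \<Longrightarrow> connected (B x)"
    "\<And>x. x \<in> k \<Longrightarrow> x \<in> B x" "\<And>x. x \<in> k \<Longrightarrow> B x \<subseteq> S \<inter> ball x (min (\<epsilon>/2) (dist x p / 2))"
    by metis
  have BX: "B x \<inter> X \<noteq> {}" if "x \<in> k" for x using B(3)[OF that] that k(1) by blast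
  have pB: "p \<notin> closure (B x)" if x: "x \<in> k" for x
  proof -
    have "B x \<subseteq> cball x (dist x p / 2)" using B(4)[OF x] by force
    then have "closure (B x) \<subseteq> cball x (dist x p / 2)" by (simp add: closure_minimal)
    moreover have "x \<noteq> p" using x p(2) by blast
    then have "0 < dist x p" by simp
    then have "p \<notin> cball x (dist x p / 2)" by simp
    ultimately show ?thesis by blast
  qed
  have "X \<noteq> {p}" using False by blast
  then have "\<exists>U \<in> components (S - X). \<forall>x\<in>k. U \<inter> B x \<noteq> {}"
    by (rule domain_meeting_all[OF S XS X _ p(1) k(2) kne B(1,2) BX pB])
  then obtain U where U: "U \<in> components (S - X)" "\<forall>x\<in>k. U \<inter> B x \<noteq> {}"
    by blast
  have "infdist y ((top_of_set S) frontier_of U) \<le> \<epsilon>" if y: "y \<in> X" for y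
  proof -
    obtain x where x: "x \<in> k" "dist x y < \<epsilon>/2" using k(3) y by auto
    have "connectedin (top_of_set S) (B x)"
      using B(2)[OF x(1)] openin_imp_subset[OF B(1)[OF x(1)]] by (simp add: connectedin_subtopology)
    moreover have "B x \<inter> U \<noteq> {}" using U(2) x(1) by blast
    moreover have "B x - U \<noteq> {}" using BX[OF x(1)] in_components_subset[OF U(1)] by blast
    ultimately have "B x \<inter> (top_of_set S) frontier_of U \<noteq> {}" by (rule connectedin_Int_frontier_of)
    then obtain z where z: "z \<in> B x" "z \<in> (top_of_set S) frontier_of U" by blast
    have "dist x z < \<epsilon>/2" using B(4)[OF x(1)] z(1) by auto
    then have "dist y z \<le> \<epsilon>" using x(2) dist_triangle[of y z x] by (simp add: dist_commute)
    then show ?thesis using infdist_le2[OF z(2)] by blast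
  qed
  then show ?thesis using U(1) by blast
qed

theorem mainTheorem5:
  fixes S X :: "'a::metric_space set"
  assumes "closed_surface S" and "X \<subseteq> S" and "indecomposable X"
  shows "\<exists>U :: nat \<Rightarrow> 'a set. (\<forall>n. complementary_domain S X (U n)) \<and>
           (\<lambda>n. hausdorff_dist ((top_of_set S) frontier_of (U n)) X) \<longlonglongrightarrow> 0"
proof -
  have X: "compact X" "X \<noteq> {}" using assms(3) by (auto simp: indecomposable_def continuum_def)
  have "\<exists>U \<in> components (S - X). \<forall>x\<in>X. infdist x ((top_of_set S) frontier_of U) \<le> 1 / Suc n" for n
    by (rule domain_frontier_dense[OF assms]) simp
  then obtain U where U: "\<And>n. U n \<in> components (S - X)"
    "\<And>n x. x \<in> X \<Longrightarrow> infdist x ((top_of_set S) frontier_of U n) \<le> 1 / Suc n"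
    by metis
  have bounds: "0 \<le> hausdorff_dist ((top_of_set S) frontier_of U n) X"
    "hausdorff_dist ((top_of_set S) frontier_of U n) X \<le> 1 / Suc n" for n
  proof -
    let ?F = "(top_of_set S) frontier_of U n"
    have FX: "?F \<subseteq> X"
      using frontier_of_component_subset[OF closed_surface_locally_connected[OF assms(1)]
          compact_imp_closed[OF X(1)] U(1)] .
    have "connectedin (top_of_set S) S"
      using assms(1) by (simp add: connectedin_subtopology closed_surface_def)
    moreover have "S \<inter> U n \<noteq> {}" "S - U n \<noteq> {}"
      using in_components_subset[OF U(1)] in_components_nonempty[OF U(1)] X(2) assms(2) by blast+
    \<comment> \<open>Nonemptiness of the frontier gives the first supremum a genuine value, which
      is 0 since the frontier lies in \<open>X\<close>.\<close>
    ultimately have "S \<inter> ?F \<noteq> {}" by (rule connectedin_Int_frontier_of)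
    then have "(\<lambda>a. infdist a X) ` ?F = {0}" using FX by force
    then have 1: "(SUP a\<in>?F. infdist a X) = 0" by simp
    have 2: "(SUP b\<in>X. infdist b ?F) \<le> 1 / Suc n"
      using X(2) U(2) by (intro cSUP_least)
    show "0 \<le> hausdorff_dist ?F X" "hausdorff_dist ?F X \<le> 1 / Suc n"
      unfolding hausdorff_dist_def 1 using 2 by simp_all
  qed
  have "(\<lambda>n. hausdorff_dist ((top_of_set S) frontier_of U n) X) \<longlonglongrightarrow> 0"
  proof (rule tendsto_sandwich)
    show "(\<lambda>n. 0) \<longlonglongrightarrow> (0::real)" by simp
    show "(\<lambda>n. 1 / real (Suc n)) \<longlonglongrightarrow> 0" using LIMSEQ_inverse_real_of_nat by (simp add: inverse_eq_divide)
  qed (use bounds in simp_all)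
  then show ?thesis using U(1) unfolding complementary_domain_def by blast
qed

end
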